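(* Let $V$ be a countably infinite set, $\mu\colon V\to(0,\infty)$, and $b\colon V\times V\to[0,\infty)$ with $b(x,y)=b(y,x)$, $b(x,x)=0$, and $\deg(x):=\#\{y\in V: b(x,y)>0\}<\infty$ for all $x,y\in V$. Assume the weighted graph $(V,b,\mu)$ is connected and that $\mu(x)\geq\mu_0$ for all $x\in V$, for some constant $\mu_0>0$. Let $\theta\colon V\times V\to[-\pi,\pi]$ satisfy $\theta(x,y)=-\theta(y,x)$. Let $q\colon[0,\infty)\to(0,\infty)$ be a non-decreasing function with $q(s)=O(s^{\alpha})$ for some $0\leq\alpha\leq 1$. Let $W\colon V\to\mathbb{R}$ satisfy $W(x)\geq -q(r(x))$ for all $x\in V$, where $r(x)=d(x_0,x)$ for a fixed vertex $x_0\in V$. In the case $0<\alpha\leq 1$, assume that the sequence $\{n^{\alpha-1}d_np_n\}_{n\in\mathbb{Z}_+}$ is bounded. In the case $\alpha=0$, assume that there exist numbers $0<K<\frac{\mu_0}{2}$ and $N\in\mathbb{Z}_+$ such that $\frac{d_np_n}{n}\leq K$ for all $n\geq N$. Then the operator $Hu=\Delta_{b,\theta}^2u+Wu$ is essentially self-adjoint on $C_c(V)$ in the Hilbert space $\ell^2(V,\mu)$.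
   Context: Vertices $x,y$ are neighbors ($x\sim y$) if $b(x,y)>0$; connectedness means any two vertices are joined by a finite path $x=x_0\sim x_1\sim\dots\sim x_n=y$, and $d(x,y)$ is the combinatorial distance (minimal number of edges in such a path). $C(V)$ denotes complex-valued functions on $V$, $C_c(V)$ the finitely supported ones, and $\ell^2(V,\mu)$ the space of $f\in C(V)$ with $\|f\|^2=\sum_{x}\mu(x)|f(x)|^2<\infty$, with inner product $(f,g)=\sum_x\mu(x)f(x)\overline{g(x)}$. The magnetic Laplacian is $(\Delta_{b,\theta}u)(x)=\frac{1}{\mu(x)}\sum_{y\in V}b(x,y)(u(x)-e^{i\theta(x,y)}u(y))$, and $\Delta_{b,\theta}^2u=\Delta_{b,\theta}(\Delta_{b,\theta}u)$. For $n\in\mathbb{Z}_+=\{1,2,\dots\}$, $B(x_0,n)$ consists of the vertices $x$ with $r(x)\leq n$ (together with edges between such vertices), $d_n:=\max_{x\in B(x_0,n)}\deg(x)$, and $p_n:=\max_{x\in B(x_0,n)}\max_{y\in V}b(x,y)$. *)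

theory Defs
  imports "HOL-Analysis.Analysis" "HOL-Library.Landau_Symbols"
begin

definition walk :: "('v \<Rightarrow> 'v \<Rightarrow> real) \<Rightarrow> nat \<Rightarrow> 'v \<Rightarrow> 'v \<Rightarrow> bool" where
  "walk b n x y \<longleftrightarrow> (\<exists>p :: nat \<Rightarrow> 'v. p 0 = x \<and> p n = y \<and> (\<forall>i<n. 0 < b (p i) (p (Suc i))))"

definition graph_connected :: "('v \<Rightarrow> 'v \<Rightarrow> real) \<Rightarrow> bool" where
  "graph_connected b \<longleftrightarrow> (\<forall>x y. \<exists>n. walk b n x y)"

definition comb_dist :: "('v \<Rightarrow> 'v \<Rightarrow> real) \<Rightarrow> 'v \<Rightarrow> 'v \<Rightarrow> nat" where
  "comb_dist b x y = (LEAST n. walk b n x y)"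

definition deg :: "('v \<Rightarrow> 'v \<Rightarrow> real) \<Rightarrow> 'v \<Rightarrow> nat" where
  "deg b x = card {y. 0 < b x y}"

definition dn :: "('v \<Rightarrow> 'v \<Rightarrow> real) \<Rightarrow> 'v \<Rightarrow> nat \<Rightarrow> real" where
  "dn b x0 n = real (Max {deg b x | x. comb_dist b x0 x \<le> n})"

definition pn :: "('v \<Rightarrow> 'v \<Rightarrow> real) \<Rightarrow> 'v \<Rightarrow> nat \<Rightarrow> real" where
  "pn b x0 n = Max {b x y | x y. comb_dist b x0 x \<le> n}"

definition mag_lap :: "('v \<Rightarrow> 'v \<Rightarrow> real) \<Rightarrow> ('v \<Rightarrow> real) \<Rightarrow> ('v \<Rightarrow> 'v \<Rightarrow> real)
    \<Rightarrow> ('v \<Rightarrow> complex) \<Rightarrow> 'v \<Rightarrow> complex" where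
  "mag_lap b \<mu> \<theta> u x = (1 / complex_of_real (\<mu> x)) *
     (\<Sum>y\<in>{y. 0 < b x y}. complex_of_real (b x y) * (u x - exp (\<i> * complex_of_real (\<theta> x y)) * u y))"

definition fin_supp :: "('v \<Rightarrow> complex) \<Rightarrow> bool" where
  "fin_supp u \<longleftrightarrow> finite {x. u x \<noteq> 0}"

definition in_l2 :: "('v \<Rightarrow> real) \<Rightarrow> ('v \<Rightarrow> complex) \<Rightarrow> bool" where
  "in_l2 \<mu> f \<longleftrightarrow> (\<lambda>x. \<mu> x * (cmod (f x))\<^sup>2) summable_on UNIV"

definition l2_norm :: "('v \<Rightarrow> real) \<Rightarrow> ('v \<Rightarrow> complex) \<Rightarrow> real" where
  "l2_norm \<mu> f = sqrt (infsum (\<lambda>x. \<mu> x * (cmod (f x))\<^sup>2) UNIV)"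

definition l2_inner :: "('v \<Rightarrow> real) \<Rightarrow> ('v \<Rightarrow> complex) \<Rightarrow> ('v \<Rightarrow> complex) \<Rightarrow> complex" where
  "l2_inner \<mu> f g = infsum (\<lambda>x. complex_of_real (\<mu> x) * f x * cnj (g x)) UNIV"

text \<open>Operators in l^2(V,mu) are represented by their graphs (sets of pairs (u, Tu)).\<close>
definition op_closure :: "('v \<Rightarrow> real) \<Rightarrow> (('v \<Rightarrow> complex) \<times> ('v \<Rightarrow> complex)) set
    \<Rightarrow> (('v \<Rightarrow> complex) \<times> ('v \<Rightarrow> complex)) set" where
  "op_closure \<mu> G = {(u, f). in_l2 \<mu> u \<and> in_l2 \<mu> f \<and>
     (\<exists>s :: nat \<Rightarrow> ('v \<Rightarrow> complex) \<times> ('v \<Rightarrow> complex). (\<forall>n. s n \<in> G) \<and>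
        (\<lambda>n. l2_norm \<mu> (\<lambda>x. fst (s n) x - u x)) \<longlonglongrightarrow> 0 \<and>
        (\<lambda>n. l2_norm \<mu> (\<lambda>x. snd (s n) x - f x)) \<longlonglongrightarrow> 0)}"

definition op_adjoint :: "('v \<Rightarrow> real) \<Rightarrow> (('v \<Rightarrow> complex) \<times> ('v \<Rightarrow> complex)) set
    \<Rightarrow> (('v \<Rightarrow> complex) \<times> ('v \<Rightarrow> complex)) set" where
  "op_adjoint \<mu> G = {(v, w). in_l2 \<mu> v \<and> in_l2 \<mu> w \<and>
     (\<forall>(u, f)\<in>G. l2_inner \<mu> f v = l2_inner \<mu> u w)}"

definition self_adjoint_op :: "('v \<Rightarrow> real) \<Rightarrow> (('v \<Rightarrow> complex) \<times> ('v \<Rightarrow> complex)) set \<Rightarrow> bool" where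
  "self_adjoint_op \<mu> T \<longleftrightarrow> op_adjoint \<mu> T = T"

definition ess_self_adjoint :: "('v \<Rightarrow> real) \<Rightarrow> (('v \<Rightarrow> complex) \<times> ('v \<Rightarrow> complex)) set \<Rightarrow> bool" where
  "ess_self_adjoint \<mu> G \<longleftrightarrow> self_adjoint_op \<mu> (op_closure \<mu> G)"

definition H_graph :: "('v \<Rightarrow> 'v \<Rightarrow> real) \<Rightarrow> ('v \<Rightarrow> real) \<Rightarrow> ('v \<Rightarrow> 'v \<Rightarrow> real) \<Rightarrow> ('v \<Rightarrow> real)
    \<Rightarrow> (('v \<Rightarrow> complex) \<times> ('v \<Rightarrow> complex)) set" where
  "H_graph b \<mu> \<theta> W = {(u, \<lambda>x. mag_lap b \<mu> \<theta> (mag_lap b \<mu> \<theta> u) x + complex_of_real (W x) * u x) | u. fin_supp u}"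

end

theory Submission
  imports Defs
begin

text \<open>By a closest-point argument in \<open>\<ell>\<^sup>2 \<times> \<ell>\<^sup>2\<close>, and since the adjoint of \<open>H\<close> on finitely
  supported functions is the maximal operator, the closure of \<open>H\<close> is self-adjoint as soon as
  \<open>H u = \<plusminus>\<i> u\<close> has no nonzero square summable solution.

  For such a \<open>u\<close> and a finitely supported cutoff \<open>\<phi>\<close>, pair the equation with \<open>\<phi>\<^sup>2 u\<close>.
  The real part bounds \<open>\<parallel>\<phi> \<Delta>u\<parallel>\<^sup>2\<close> by the size \<open>M\<close> of the negative part of \<open>W\<close> on the support of
  \<open>\<phi>\<close>, and the imaginary part bounds \<open>\<parallel>\<phi> u\<parallel>\<^sup>2\<close> by the commutator terms, which are of order
  \<open>\<epsilon> (\<epsilon> + sqrt M)\<close> where \<open>\<epsilon>\<close> is the norm of the commutator of \<open>\<Delta>\<close> with \<open>\<phi>\<close>. A cutoff that is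
  logarithmic in \<open>r\<close> and decreases from \<open>1\<close> to \<open>0\<close> between the radii \<open>N\<close> and \<open>N\<^sup>3\<^sup>/\<^sup>2\<close> gives
  \<open>\<epsilon> = O(N\<^sup>-\<^sup>\<alpha> / ln N)\<close> and \<open>M = O(N\<^sup>3\<^sup>\<alpha>\<^sup>/\<^sup>2)\<close>, so that these terms vanish as \<open>N\<close> grows, for every
  \<open>\<alpha>\<close> in \<open>[0, 1]\<close>.\<close>

section \<open>Weighted square summable functions\<close>

text \<open>The square of \<open>l2_norm\<close>. Without the root, the parallelogram law and the
  expansion of the norm of a difference stay polynomial.\<close>

definition sq_norm :: "('a \<Rightarrow> real) \<Rightarrow> ('a \<Rightarrow> complex) \<Rightarrow> real" where
  "sq_norm m f = infsum (\<lambda>x. m x * (cmod (f x))\<^sup>2) UNIV"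

lemma l2_norm_eq_sqrt: "l2_norm m f = sqrt (sq_norm m f)"
  by (simp add: l2_norm_def sq_norm_def)

lemma cmod_add_sq_le: "(cmod (a + b))\<^sup>2 \<le> 2 * (cmod a)\<^sup>2 + 2 * (cmod b)\<^sup>2"
proof -
  have "(cmod (a + b))\<^sup>2 \<le> (cmod a + cmod b)\<^sup>2"
    by (intro power_mono norm_triangle_ineq) auto
  also have "\<dots> \<le> 2 * (cmod a)\<^sup>2 + 2 * (cmod b)\<^sup>2"
    using sum_squares_bound[of "cmod a" "cmod b"] by (simp add: power2_sum)
  finally show ?thesis .
qed

text \<open>The index type is arbitrary because there are two instances: \<open>\<mu>\<close> on the
  vertices, and \<open>case_sum \<mu> \<mu>\<close> on two disjoint copies of them, where a function
  stands for a pair.\<close>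

locale weight =
  fixes m :: "'a \<Rightarrow> real"
  assumes m_pos: "0 < m x"
begin

lemma m_nonneg [simp]: "0 \<le> m x"
  using m_pos[of x] by simp

lemma sq_norm_nonneg [simp]: "0 \<le> sq_norm m f"
  unfolding sq_norm_def by (intro infsum_nonneg) auto

lemma finite_sum_le_sq_norm:
  assumes "in_l2 m f" "finite F"
  shows "(\<Sum>x\<in>F. m x * (cmod (f x))\<^sup>2) \<le> sq_norm m f"
  unfolding sq_norm_def by (rule finite_sum_le_infsum) (use assms in \<open>auto simp: in_l2_def\<close>)

lemma point_le_sq_norm:
  assumes "in_l2 m f"
  shows "m x * (cmod (f x))\<^sup>2 \<le> sq_norm m f"
  using finite_sum_le_sq_norm[OF assms, of "{x}"] by simp

text \<open>All terms are nonnegative, so bounded finite sums give summability and the bound on the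
  total; this plays the part of Fatou's lemma in the completeness proof.\<close>

lemma bounded_partial_sums_l2:
  assumes "\<And>F. finite F \<Longrightarrow> (\<Sum>x\<in>F. m x * (cmod (f x))\<^sup>2) \<le> C"
  shows "in_l2 m f" "sq_norm m f \<le> C"
proof -
  show *: "in_l2 m f"
    unfolding in_l2_def
    by (rule nonneg_bdd_above_summable_on) (use assms in \<open>auto intro!: bdd_aboveI2[where M = C]\<close>)
  show "sq_norm m f \<le> C"
    unfolding sq_norm_def
    by (rule infsum_le_finite_sums) (use * assms in \<open>auto simp: in_l2_def\<close>)
qed

lemma in_l2_add:
  assumes "in_l2 m f" "in_l2 m g"
  shows "in_l2 m (\<lambda>x. f x + g x)"
  unfolding in_l2_def
proof (rule summable_on_comparison_test)
  show "(\<lambda>x. 2 * (m x * (cmod (f x))\<^sup>2) + 2 * (m x * (cmod (g x))\<^sup>2)) summable_on UNIV"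
    using assms by (intro summable_on_add summable_on_cmult_right) (auto simp: in_l2_def)
  show "m x * (cmod (f x + g x))\<^sup>2 \<le> 2 * (m x * (cmod (f x))\<^sup>2) + 2 * (m x * (cmod (g x))\<^sup>2)" for x
    using mult_left_mono[OF cmod_add_sq_le[of "f x" "g x"], of "m x"] by (simp add: algebra_simps)
qed auto

lemma in_l2_scale:
  assumes "in_l2 m f"
  shows "in_l2 m (\<lambda>x. c * f x)"
proof -
  have "(\<lambda>x. (cmod c)\<^sup>2 * (m x * (cmod (f x))\<^sup>2)) summable_on UNIV"
    using assms by (intro summable_on_cmult_right) (auto simp: in_l2_def)
  then show ?thesis
    by (simp add: in_l2_def norm_mult power_mult_distrib algebra_simps)
qed

lemma in_l2_minus:
  assumes "in_l2 m f"
  shows "in_l2 m (\<lambda>x. - f x)"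
  using in_l2_scale[OF assms, of "-1"] by simp

lemma in_l2_diff:
  assumes "in_l2 m f" "in_l2 m g"
  shows "in_l2 m (\<lambda>x. f x - g x)"
  using in_l2_add[OF assms(1) in_l2_minus[OF assms(2)]] by simp

lemma fin_supp_in_l2:
  assumes "fin_supp f"
  shows "in_l2 m f"
  unfolding in_l2_def
  by (rule finite_nonzero_values_imp_summable_on)
     (rule finite_subset[OF _ assms[unfolded fin_supp_def]], auto)

lemma abs_summable_inner:
  assumes "in_l2 m f" "in_l2 m g"
  shows "(\<lambda>x. norm (complex_of_real (m x) * f x * cnj (g x))) summable_on UNIV"
proof (rule Infinite_Sum.abs_summable_on_comparison_test')
  show "(\<lambda>x. m x * (cmod (f x))\<^sup>2 + m x * (cmod (g x))\<^sup>2) summable_on UNIV"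
    using assms by (intro summable_on_add) (auto simp: in_l2_def)
  show "norm (complex_of_real (m x) * f x * cnj (g x)) \<le> m x * (cmod (f x))\<^sup>2 + m x * (cmod (g x))\<^sup>2" for x
  proof -
    have "0 \<le> cmod (f x) * cmod (g x)" by simp
    then have "cmod (f x) * cmod (g x) \<le> (cmod (f x))\<^sup>2 + (cmod (g x))\<^sup>2"
      using sum_squares_bound[of "cmod (f x)" "cmod (g x)"] by linarith
    from mult_left_mono[OF this, of "m x"] show ?thesis
      by (simp add: norm_mult algebra_simps)
  qed
qed

lemma summable_inner:
  assumes "in_l2 m f" "in_l2 m g"
  shows "(\<lambda>x. complex_of_real (m x) * f x * cnj (g x)) summable_on UNIV"
  using abs_summable_inner[OF assms] by (rule Infinite_Sum.abs_summable_summable)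

lemma l2_inner_add_left:
  assumes "in_l2 m f" "in_l2 m g" "in_l2 m h"
  shows "l2_inner m (\<lambda>x. f x + g x) h = l2_inner m f h + l2_inner m g h"
  using infsum_add[OF summable_inner[OF assms(1,3)] summable_inner[OF assms(2,3)]]
  by (simp add: l2_inner_def algebra_simps)

lemma l2_inner_scale_left: "l2_inner m (\<lambda>x. c * f x) g = c * l2_inner m f g"
  using infsum_cmult_right'[of c "\<lambda>x. complex_of_real (m x) * f x * cnj (g x)" UNIV]
  by (simp add: l2_inner_def algebra_simps)

lemma l2_inner_cnj: "cnj (l2_inner m f g) = l2_inner m g f"
  unfolding l2_inner_def infsum_cnj[symmetric] by (simp add: algebra_simps)

lemma l2_inner_diff_left:
  assumes "in_l2 m f" "in_l2 m g" "in_l2 m h"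
  shows "l2_inner m (\<lambda>x. f x - g x) h = l2_inner m f h - l2_inner m g h"
  using l2_inner_add_left[OF assms(1) in_l2_minus[OF assms(2)] assms(3)]
    l2_inner_scale_left[of "-1" g h] by simp

lemma l2_inner_diff_right:
  assumes "in_l2 m f" "in_l2 m g" "in_l2 m h"
  shows "l2_inner m h (\<lambda>x. f x - g x) = l2_inner m h f - l2_inner m h g"
  using l2_inner_diff_left[OF assms] by (metis complex_cnj_diff l2_inner_cnj)

lemma l2_inner_scale_right: "l2_inner m f (\<lambda>x. c * g x) = cnj c * l2_inner m f g"
  using l2_inner_scale_left[of c g f] by (metis complex_cnj_mult l2_inner_cnj)

lemma l2_inner_self:
  assumes "in_l2 m f"
  shows "l2_inner m f f = complex_of_real (sq_norm m f)"
proof -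
  have "of_real (m x) * f x * cnj (f x) = complex_of_real (m x * (cmod (f x))\<^sup>2)" for x
    using complex_norm_square[of "f x"] by (simp add: mult.assoc)
  then show ?thesis
    unfolding l2_inner_def sq_norm_def
    using assms by (simp only: infsumI[OF has_sum_of_real[OF has_sum_infsum]] in_l2_def)
qed

lemma sq_norm_diff:
  assumes "in_l2 m f" "in_l2 m g"
  shows "sq_norm m (\<lambda>x. f x - g x) = sq_norm m f + sq_norm m g - 2 * Re (l2_inner m f g)"
proof -
  have d: "in_l2 m (\<lambda>x. f x - g x)" by (rule in_l2_diff[OF assms])
  have "complex_of_real (sq_norm m (\<lambda>x. f x - g x)) =
      l2_inner m f f + l2_inner m g g - l2_inner m f g - cnj (l2_inner m f g)"
    unfolding l2_inner_self[OF d, symmetric] l2_inner_cnj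
    by (simp add: l2_inner_diff_left l2_inner_diff_right assms d)
  then have "Re (complex_of_real (sq_norm m (\<lambda>x. f x - g x))) =
      Re (l2_inner m f f + l2_inner m g g - l2_inner m f g - cnj (l2_inner m f g))"
    by simp
  then show ?thesis by (simp add: l2_inner_self assms)
qed

lemma sq_norm_scale: "sq_norm m (\<lambda>x. c * f x) = (cmod c)\<^sup>2 * sq_norm m f"
  using infsum_cmult_right'[of "(cmod c)\<^sup>2" "\<lambda>x. m x * (cmod (f x))\<^sup>2" UNIV]
  by (simp add: sq_norm_def norm_mult power_mult_distrib algebra_simps)

lemma sq_norm_minus: "sq_norm m (\<lambda>x. f x - g x) = sq_norm m (\<lambda>x. g x - f x)"
  by (simp add: sq_norm_def norm_minus_commute)

text \<open>The finite inequality for \<open>sqrt (m x) * cmod (f x)\<close> has a bound independent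
  of the finite set, so it survives for the infinite sum.\<close>

lemma Cauchy_Schwarz_l2:
  assumes "in_l2 m f" "in_l2 m g"
  shows "cmod (l2_inner m f g) \<le> l2_norm m f * l2_norm m g"
proof -
  have "cmod (l2_inner m f g) \<le> infsum (\<lambda>x. norm (complex_of_real (m x) * f x * cnj (g x))) UNIV"
    unfolding l2_inner_def by (rule norm_infsum_bound[OF abs_summable_inner[OF assms]])
  also have "\<dots> \<le> l2_norm m f * l2_norm m g"
  proof (rule infsum_le_finite_sums[OF abs_summable_inner[OF assms]])
    fix F :: "'a set" assume F: "finite F"
    have sq: "(sqrt (m x) * cmod (h x))\<^sup>2 = m x * (cmod (h x))\<^sup>2" for x h
      by (simp add: power_mult_distrib)
    have "(\<Sum>x\<in>F. norm (complex_of_real (m x) * f x * cnj (g x)))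
        = (\<Sum>x\<in>F. \<bar>sqrt (m x) * cmod (f x)\<bar> * \<bar>sqrt (m x) * cmod (g x)\<bar>)"
    proof (rule sum.cong[OF refl])
      fix x
      have "m x = sqrt (m x) * sqrt (m x)" by simp
      then show "norm (complex_of_real (m x) * f x * cnj (g x))
        = \<bar>sqrt (m x) * cmod (f x)\<bar> * \<bar>sqrt (m x) * cmod (g x)\<bar>"
        by (simp add: norm_mult abs_mult)
    qed
    also have "\<dots> \<le> L2_set (\<lambda>x. sqrt (m x) * cmod (f x)) F * L2_set (\<lambda>x. sqrt (m x) * cmod (g x)) F"
      by (rule L2_set_mult_ineq)
    also have "\<dots> \<le> l2_norm m f * l2_norm m g"
      unfolding L2_set_def l2_norm_eq_sqrt sq
      by (intro mult_mono real_sqrt_le_mono finite_sum_le_sq_norm F assms) (auto intro!: sum_nonneg)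
    finally show "(\<Sum>x\<in>F. norm (complex_of_real (m x) * f x * cnj (g x))) \<le> l2_norm m f * l2_norm m g" .
  qed
  finally show ?thesis .
qed

section \<open>Convergence, completeness and projection in the weighted space\<close>

lemma l2_inner_tendsto:
  assumes "\<And>n. in_l2 m (s n)" "in_l2 m p" "in_l2 m g"
    and lim: "(\<lambda>n. l2_norm m (\<lambda>x. s n x - p x)) \<longlonglongrightarrow> 0"
  shows "(\<lambda>n. l2_inner m (s n) g) \<longlonglongrightarrow> l2_inner m p g"
proof (rule LIM_zero_cancel, rule Lim_null_comparison)
  show "(\<lambda>n. l2_norm m (\<lambda>x. s n x - p x) * l2_norm m g) \<longlonglongrightarrow> 0"
    using tendsto_mult_right[OF lim, of "l2_norm m g"] by (simp add: mult.commute)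
  show "\<forall>\<^sub>F n in sequentially.
      norm (l2_inner m (s n) g - l2_inner m p g) \<le> l2_norm m (\<lambda>x. s n x - p x) * l2_norm m g"
  proof (rule always_eventually, rule allI)
    fix n
    show "norm (l2_inner m (s n) g - l2_inner m p g) \<le> l2_norm m (\<lambda>x. s n x - p x) * l2_norm m g"
      using Cauchy_Schwarz_l2[OF in_l2_diff[OF assms(1,2)] assms(3), of n]
      by (simp add: l2_inner_diff_left assms)
  qed
qed

text \<open>Each point carries positive mass, so the norm of a difference controls its value at x up
  to the factor \<open>1 / sqrt (m x)\<close>.\<close>

lemma l2_tendsto_pointwise:
  assumes "\<And>n. in_l2 m (s n)" "in_l2 m p"
    and lim: "(\<lambda>n. l2_norm m (\<lambda>x. s n x - p x)) \<longlonglongrightarrow> 0"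
  shows "(\<lambda>n. s n x) \<longlonglongrightarrow> p x"
proof (rule LIM_zero_cancel, rule Lim_null_comparison)
  show "(\<lambda>n. l2_norm m (\<lambda>x. s n x - p x) / sqrt (m x)) \<longlonglongrightarrow> 0"
    using tendsto_divide_zero[OF lim] .
  show "\<forall>\<^sub>F n in sequentially. norm (s n x - p x) \<le> l2_norm m (\<lambda>x. s n x - p x) / sqrt (m x)"
  proof (rule always_eventually, rule allI)
    fix n
    have "sqrt (m x * (cmod (s n x - p x))\<^sup>2) \<le> l2_norm m (\<lambda>x. s n x - p x)"
      unfolding l2_norm_eq_sqrt
      by (rule real_sqrt_le_mono) (rule point_le_sq_norm[OF in_l2_diff[OF assms(1,2)]])
    then show "norm (s n x - p x) \<le> l2_norm m (\<lambda>x. s n x - p x) / sqrt (m x)"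
      using m_pos[of x] by (simp add: real_sqrt_mult field_simps)
  qed
qed

text \<open>The limit is built pointwise and then upgraded to a norm limit. The Cauchy condition has
  the form \<open>e j + e k\<close> because that is what a minimising sequence yields.\<close>

lemma l2_complete:
  fixes s :: "nat \<Rightarrow> 'a \<Rightarrow> complex"
  assumes s: "\<And>n. in_l2 m (s n)"
    and bound: "\<And>j k. sq_norm m (\<lambda>x. s j x - s k x) \<le> e j + e k"
    and e: "e \<longlonglongrightarrow> 0"
  obtains p where "in_l2 m p" "(\<lambda>n. l2_norm m (\<lambda>x. s n x - p x)) \<longlonglongrightarrow> 0"
proof -
  have e0: "0 \<le> e j" for j
    using order_trans[OF sq_norm_nonneg bound[of j j]] by simp
  have "Cauchy (\<lambda>n. s n x)" for x
  proof (rule CauchyI)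
    fix r :: real assume r: "0 < r"
    then have "0 < m x * r\<^sup>2 / 2" using m_pos[of x] by simp
    from order_tendstoD(2)[OF e this] obtain N where N: "\<And>n. n \<ge> N \<Longrightarrow> e n < m x * r\<^sup>2 / 2"
      unfolding eventually_sequentially by blast
    show "\<exists>M. \<forall>j\<ge>M. \<forall>k\<ge>M. norm (s j x - s k x) < r"
    proof (intro exI allI impI)
      fix j k assume "N \<le> j" "N \<le> k"
      then have "e j + e k < m x * r\<^sup>2" using N[of j] N[of k] by simp
      then have "m x * (cmod (s j x - s k x))\<^sup>2 < m x * r\<^sup>2"
        using point_le_sq_norm[OF in_l2_diff[OF s s], of x j k] bound[of j k] by linarith
      then have "(cmod (s j x - s k x))\<^sup>2 < r\<^sup>2" using m_pos[of x] by simp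
      then show "norm (s j x - s k x) < r" using r by (simp add: power_less_imp_less_base)
    qed
  qed
  then have "\<forall>x. \<exists>l. (\<lambda>n. s n x) \<longlonglongrightarrow> l"
    using Cauchy_convergent unfolding convergent_def by blast
  then obtain p where p: "\<And>x. (\<lambda>n. s n x) \<longlonglongrightarrow> p x" by metis
  \<comment> \<open>On a finite set k may tend to infinity term by term; the resulting bound does
    not depend on \<open>F\<close> and so passes to the full sum.\<close>
  have fin: "(\<Sum>x\<in>F. m x * (cmod (s j x - p x))\<^sup>2) \<le> e j" if "finite F" for F j
  proof (rule LIMSEQ_le)
    show "(\<lambda>k. \<Sum>x\<in>F. m x * (cmod (s j x - s k x))\<^sup>2) \<longlonglongrightarrow> (\<Sum>x\<in>F. m x * (cmod (s j x - p x))\<^sup>2)"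
      by (intro tendsto_intros p)
    show "(\<lambda>k. e j + e k) \<longlonglongrightarrow> e j"
      using tendsto_add[OF tendsto_const e, of "e j"] by simp
    show "\<exists>N. \<forall>k\<ge>N. (\<Sum>x\<in>F. m x * (cmod (s j x - s k x))\<^sup>2) \<le> e j + e k"
      using order_trans[OF finite_sum_le_sq_norm[OF in_l2_diff[OF s s] that] bound] by blast
  qed
  have d: "in_l2 m (\<lambda>x. s j x - p x)" and n: "sq_norm m (\<lambda>x. s j x - p x) \<le> e j" for j
    using bounded_partial_sums_l2[OF fin, of j] by auto
  have "in_l2 m p"
    using in_l2_diff[OF s[of 0] d[of 0]] by simp
  moreover have "(\<lambda>n. sq_norm m (\<lambda>x. s n x - p x)) \<longlonglongrightarrow> 0"
    by (rule tendsto_sandwich[OF _ _ tendsto_const e]) (use n in auto)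
  then have "(\<lambda>n. l2_norm m (\<lambda>x. s n x - p x)) \<longlonglongrightarrow> 0"
    unfolding l2_norm_eq_sqrt using tendsto_real_sqrt by fastforce
  ultimately show ?thesis by (rule that)
qed

text \<open>A sequence in \<open>S\<close> minimising the distance to \<open>w\<close> converges,
  and minimality makes the residual orthogonal to \<open>S\<close>. Since \<open>S\<close> need not
  be closed, \<open>p\<close> is delivered as a norm limit of elements of \<open>S\<close>.\<close>

lemma l2_projection:
  assumes S: "\<And>f. f \<in> S \<Longrightarrow> in_l2 m f" and zero: "(\<lambda>_. 0) \<in> S"
    and add: "\<And>f g. f \<in> S \<Longrightarrow> g \<in> S \<Longrightarrow> (\<lambda>x. f x + g x) \<in> S"
    and scale: "\<And>c f. f \<in> S \<Longrightarrow> (\<lambda>x. c * f x) \<in> S"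
    and w: "in_l2 m w"
  obtains s p where "\<forall>n::nat. s n \<in> S" "in_l2 m p"
    "(\<lambda>n. l2_norm m (\<lambda>x. s n x - p x)) \<longlonglongrightarrow> 0"
    "\<forall>g\<in>S. l2_inner m g (\<lambda>x. w x - p x) = 0"
proof -
  define D where "D = (\<lambda>f. sq_norm m (\<lambda>x. w x - f x)) ` S"
  have D: "bdd_below D" "D \<noteq> {}"
    using zero by (auto simp: D_def intro!: bdd_belowI2[where m = 0])
  define d where "d = Inf D"
  have dle: "d \<le> sq_norm m (\<lambda>x. w x - f x)" if "f \<in> S" for f
    unfolding d_def using D that by (auto simp: D_def intro!: cInf_lower)
  have "\<exists>f\<in>S. sq_norm m (\<lambda>x. w x - f x) < d + inverse (real (Suc n))" for n
    using cInf_lessD[OF D(2), of "d + inverse (real (Suc n))"] by (auto simp: d_def D_def)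
  then obtain s where sS: "\<And>n. s n \<in> S"
    and sd: "\<And>n. sq_norm m (\<lambda>x. w x - s n x) < d + inverse (real (Suc n))"
    by metis
  have sl: "in_l2 m (s n)" for n using sS S by blast
  \<comment> \<open>Parallelogram law for the residuals of \<open>s j\<close> and
    \<open>s k\<close>: their midpoint is in \<open>S\<close>, hence at squared distance at least
    \<open>d\<close> from \<open>w\<close>, and only the two slacks remain.\<close>
  have bound: "sq_norm m (\<lambda>x. s j x - s k x) \<le> 2 * inverse (real (Suc j)) + 2 * inverse (real (Suc k))" for j k
  proof -
    define f where "f = (\<lambda>x. w x - s j x)"
    define g where "g = (\<lambda>x. w x - s k x)"
    have fg: "in_l2 m f" "in_l2 m g" "in_l2 m (\<lambda>x. - g x)"
      unfolding f_def g_def by (auto intro!: in_l2_diff in_l2_minus w sl)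
    have i: "l2_inner m f (\<lambda>x. - g x) = - l2_inner m f g"
      using l2_inner_scale_right[of f "-1" g] by simp
    have sn: "sq_norm m (\<lambda>x. - g x) = sq_norm m g"
      using sq_norm_scale[of "-1" g] by simp
    have "sq_norm m (\<lambda>x. f x - g x) + sq_norm m (\<lambda>x. f x - - g x) = 2 * sq_norm m f + 2 * sq_norm m g"
      unfolding sq_norm_diff[OF fg(1,2)] sq_norm_diff[OF fg(1,3)] i sn by simp
    moreover have "(\<lambda>x. f x - - g x) = (\<lambda>x. 2 * (w x - (1/2) * (s j x + s k x)))"
      by (auto simp: f_def g_def fun_eq_iff algebra_simps)
    then have "sq_norm m (\<lambda>x. f x - - g x) = 4 * sq_norm m (\<lambda>x. w x - (1/2) * (s j x + s k x))"
      using sq_norm_scale[of 2 "\<lambda>x. w x - (1/2) * (s j x + s k x)"] by simp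
    moreover have "d \<le> sq_norm m (\<lambda>x. w x - (1/2) * (s j x + s k x))"
      by (intro dle scale add sS)
    moreover have "sq_norm m (\<lambda>x. f x - g x) = sq_norm m (\<lambda>x. s k x - s j x)"
      by (simp add: f_def g_def)
    moreover have "sq_norm m f < d + inverse (real (Suc j))" "sq_norm m g < d + inverse (real (Suc k))"
      unfolding f_def g_def by (rule sd)+
    ultimately have "sq_norm m (\<lambda>x. s k x - s j x) \<le> 2 * inverse (real (Suc j)) + 2 * inverse (real (Suc k))"
      by linarith
    then show ?thesis by (simp only: sq_norm_minus[of "s j"])
  qed
  have e: "(\<lambda>n. 2 * inverse (real (Suc n))) \<longlonglongrightarrow> 0"
    using tendsto_mult_right[OF LIMSEQ_inverse_real_of_nat, of 2] by simp
  obtain p where p: "in_l2 m p" and lim: "(\<lambda>n. l2_norm m (\<lambda>x. s n x - p x)) \<longlonglongrightarrow> 0"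
    using l2_complete[OF sl bound e] by blast
  have "l2_inner m g (\<lambda>x. w x - p x) = 0" if g: "g \<in> S" for g
  proof -
    have gl: "in_l2 m g" by (rule S[OF g])
    define c where "c = l2_inner m (\<lambda>x. w x - p x) g"
    have lc: "(\<lambda>n. l2_inner m (\<lambda>x. w x - s n x) g) \<longlonglongrightarrow> c"
      unfolding c_def using tendsto_diff[OF tendsto_const l2_inner_tendsto[OF sl p gl lim]]
      by (simp add: l2_inner_diff_left w sl p gl)
    \<comment> \<open>Moving \<open>s n\<close> by a multiple of \<open>g\<close> stays in
      \<open>S\<close> and cannot bring the squared distance below \<open>d\<close>; the slack
      vanishes in the limit.\<close>
    have key: "2 * Re (cnj t * c) \<le> (cmod t)\<^sup>2 * sq_norm m g" for t
    proof (rule LIMSEQ_le)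
      show "(\<lambda>n. 2 * Re (cnj t * l2_inner m (\<lambda>x. w x - s n x) g)) \<longlonglongrightarrow> 2 * Re (cnj t * c)"
        by (intro tendsto_intros lc)
      show "(\<lambda>n. inverse (real (Suc n)) + (cmod t)\<^sup>2 * sq_norm m g) \<longlonglongrightarrow> (cmod t)\<^sup>2 * sq_norm m g"
        using tendsto_add[OF LIMSEQ_inverse_real_of_nat tendsto_const] by simp
      show "\<exists>N. \<forall>n\<ge>N. 2 * Re (cnj t * l2_inner m (\<lambda>x. w x - s n x) g)
          \<le> inverse (real (Suc n)) + (cmod t)\<^sup>2 * sq_norm m g"
      proof (intro exI allI impI)
        fix n
        have "d \<le> sq_norm m (\<lambda>x. w x - (s n x + t * g x))"
          by (intro dle add scale sS g)
        also have "(\<lambda>x. w x - (s n x + t * g x)) = (\<lambda>x. (w x - s n x) - t * g x)"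
          by (simp add: algebra_simps)
        also have "sq_norm m \<dots> = sq_norm m (\<lambda>x. w x - s n x) + (cmod t)\<^sup>2 * sq_norm m g
            - 2 * Re (cnj t * l2_inner m (\<lambda>x. w x - s n x) g)"
          by (simp only: sq_norm_diff[OF in_l2_diff[OF w sl] in_l2_scale[OF gl]]
              sq_norm_scale l2_inner_scale_right)
        finally show "2 * Re (cnj t * l2_inner m (\<lambda>x. w x - s n x) g)
          \<le> inverse (real (Suc n)) + (cmod t)\<^sup>2 * sq_norm m g"
          using sd[of n] by linarith
      qed
    qed
    \<comment> \<open>With t equal to \<tau> times c, the left side of \<open>key\<close> is twice
      an upper bound of its right side, which forces c = 0. The added 1 covers a vanishing norm of
      \<open>g\<close>.\<close>
    define \<tau> where "\<tau> = inverse (sq_norm m g + 1)"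
    have pos: "0 < sq_norm m g + 1" using sq_norm_nonneg[of g] by linarith
    then have \<tau>: "0 < \<tau>" "\<tau> * sq_norm m g \<le> 1" by (auto simp: \<tau>_def field_simps)
    have "Re (cnj (of_real \<tau> * c) * c) = \<tau> * (cmod c)\<^sup>2"
      unfolding cmod_power2 by (simp add: power2_eq_square algebra_simps)
    then have "2 * (\<tau> * (cmod c)\<^sup>2) \<le> \<tau> * (cmod c)\<^sup>2 * (\<tau> * sq_norm m g)"
      using key[of "of_real \<tau> * c"] \<tau> by (simp add: norm_mult power2_eq_square algebra_simps)
    also have "\<dots> \<le> \<tau> * (cmod c)\<^sup>2 * 1"
      by (rule mult_left_mono) (use \<tau> in auto)
    finally have "\<tau> * (cmod c)\<^sup>2 \<le> 0" by simp
    then have "(cmod c)\<^sup>2 \<le> 0" using \<tau> by (simp add: mult_le_0_iff)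
    then have "c = 0" by simp
    then show ?thesis using l2_inner_cnj[of "\<lambda>x. w x - p x" g] by (simp add: c_def)
  qed
  then show ?thesis using sS p lim by (intro that) auto
qed

end

section \<open>The formal operator and its adjoint\<close>

text \<open>Finite support of \<open>f\<close> alone suffices, so pairings with functions possibly
  outside the Hilbert space, such as \<open>Lap v\<close> for square summable \<open>v\<close>, are
  meaningful.\<close>

lemma summable_inner_fin_supp:
  assumes "fin_supp f"
  shows "(\<lambda>x. complex_of_real (m x) * f x * cnj (g x)) summable_on UNIV"
  by (rule finite_nonzero_values_imp_summable_on)
     (rule finite_subset[OF _ assms[unfolded fin_supp_def]], auto)

lemma l2_inner_finite:
  assumes "finite F" "\<And>x. x \<notin> F \<Longrightarrow> f x = 0"
  shows "l2_inner m f g = (\<Sum>x\<in>F. complex_of_real (m x) * f x * cnj (g x))"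
  unfolding l2_inner_def infsum_finite[OF assms(1), symmetric]
  by (rule infsum_cong_neutral) (use assms(2) in auto)

locale magnetic_graph = weight \<mu> for \<mu> :: "'v \<Rightarrow> real" +
  fixes b :: "'v \<Rightarrow> 'v \<Rightarrow> real" and \<theta> :: "'v \<Rightarrow> 'v \<Rightarrow> real" and W :: "'v \<Rightarrow> real"
  assumes b_nonneg: "0 \<le> b x y"
    and b_sym: "b x y = b y x"
    and deg_fin: "finite {y. 0 < b x y}"
    and theta_anti: "\<theta> x y = - \<theta> y x"
begin

abbreviation nbrs :: "'v \<Rightarrow> 'v set" where
  "nbrs x \<equiv> {y. 0 < b x y}"

abbreviation phase :: "'v \<Rightarrow> 'v \<Rightarrow> complex" where
  "phase x y \<equiv> exp (\<i> * complex_of_real (\<theta> x y))"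

abbreviation Lap :: "('v \<Rightarrow> complex) \<Rightarrow> 'v \<Rightarrow> complex" where
  "Lap \<equiv> mag_lap b \<mu> \<theta>"

text \<open>The expression for \<open>H\<close> acts on every function, as each sum runs over a
  finite neighbour set; \<open>core\<close> is its restriction to finitely supported
  functions.\<close>

definition formal_H :: "('v \<Rightarrow> complex) \<Rightarrow> 'v \<Rightarrow> complex" where
  "formal_H u x = Lap (Lap u) x + complex_of_real (W x) * u x"

abbreviation core :: "(('v \<Rightarrow> complex) \<times> ('v \<Rightarrow> complex)) set" where
  "core \<equiv> H_graph b \<mu> \<theta> W"

lemma core_eq: "core = {(u, formal_H u) | u. fin_supp u}"
proof -
  have "formal_H u = (\<lambda>x. Lap (Lap u) x + complex_of_real (W x) * u x)" for u
    by (simp add: formal_H_def fun_eq_iff)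
  then show ?thesis by (simp only: H_graph_def)
qed

lemma b_zero: "y \<notin> nbrs x \<Longrightarrow> b x y = 0"
  using b_nonneg[of x y] by simp

lemma cnj_phase: "cnj (phase x y) = phase y x"
  using theta_anti[of x y] by (simp add: exp_cnj)

text \<open>The closed 1-neighbourhood: applying \<open>Lap\<close> enlarges a support by at most
  one step.\<close>

definition neighbourhood :: "'v set \<Rightarrow> 'v set" where
  "neighbourhood A = A \<union> (\<Union>x\<in>A. nbrs x)"

lemma finite_neighbourhood: "finite A \<Longrightarrow> finite (neighbourhood A)"
  using deg_fin by (auto simp: neighbourhood_def)

lemma Lap_zero_outside:
  assumes "\<And>x. x \<notin> A \<Longrightarrow> u x = 0" "x \<notin> neighbourhood A"
  shows "Lap u x = 0"
proof -
  have "u y = 0" if "0 < b x y" for y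
    using assms that b_sym[of x y] by (auto simp: neighbourhood_def)
  moreover have "u x = 0" using assms by (auto simp: neighbourhood_def)
  ultimately show ?thesis by (simp add: mag_lap_def)
qed

lemma fin_supp_Lap:
  assumes "fin_supp u"
  shows "fin_supp (Lap u)"
  unfolding fin_supp_def
proof (rule finite_subset)
  show "{x. Lap u x \<noteq> 0} \<subseteq> neighbourhood {x. u x \<noteq> 0}"
    using Lap_zero_outside[of "{x. u x \<noteq> 0}" u] by auto
  show "finite (neighbourhood {x. u x \<noteq> 0})"
    using assms by (simp add: finite_neighbourhood fin_supp_def)
qed

lemma fin_supp_formal_H:
  assumes "fin_supp u"
  shows "fin_supp (formal_H u)"
proof -
  have "{x. formal_H u x \<noteq> 0} \<subseteq> {x. Lap (Lap u) x \<noteq> 0} \<union> {x. u x \<noteq> 0}"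
    by (auto simp: formal_H_def)
  moreover have "finite ({x. Lap (Lap u) x \<noteq> 0} \<union> {x. u x \<noteq> 0})"
    using fin_supp_Lap[OF fin_supp_Lap[OF assms]] assms by (simp add: fin_supp_def)
  ultimately show ?thesis unfolding fin_supp_def by (rule finite_subset)
qed

text \<open>Clearing the weight separates a real diagonal part from the Hermitian kernel
  \<open>b x y * phase x y\<close>; Green's formula rests on this splitting.\<close>

lemma mu_Lap:
  "complex_of_real (\<mu> x) * Lap u x =
    (\<Sum>y\<in>nbrs x. complex_of_real (b x y) * u x) -
    (\<Sum>y\<in>nbrs x. complex_of_real (b x y) * phase x y * u y)"
  using m_pos[of x] by (simp add: mag_lap_def right_diff_distrib sum_subtractf mult.assoc)

text \<open>The Hermitian kernel moves to the other argument once the double sum is finite;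
  \<open>v\<close> may be arbitrary because the support of \<open>u\<close> already cuts the
  sum.\<close>

lemma Lap_green:
  assumes "fin_supp u"
  shows "l2_inner \<mu> (Lap u) v = l2_inner \<mu> u (Lap v)"
proof -
  define A where "A = {x. u x \<noteq> 0}"
  define F where "F = neighbourhood A"
  have A: "\<And>x. x \<notin> A \<Longrightarrow> u x = 0" by (simp add: A_def)
  have F: "finite F" "A \<subseteq> F"
    using assms finite_neighbourhood by (auto simp: A_def F_def fin_supp_def neighbourhood_def)
  have u0: "\<And>x. x \<notin> F \<Longrightarrow> u x = 0" using A F(2) by auto
  let ?K = "\<lambda>x y. complex_of_real (b x y) * phase x y * u y * cnj (v x)"
  \<comment> \<open>Both neighbour sums become sums over the same finite \<open>F\<close>, so that
    the order can be exchanged. In \<open>r\<close>, a vertex with \<open>u x \<noteq> 0\<close> has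
    all its neighbours in \<open>F\<close>.\<close>
  have l: "(\<Sum>y\<in>nbrs x. ?K x y) = (\<Sum>y\<in>F. ?K x y)" for x
  proof (rule sum.mono_neutral_cong[OF F(1) deg_fin])
    show "?K x y = 0" if "y \<in> F - nbrs x" for y
      using b_zero[of y x] that by (simp only: Diff_iff) simp
    show "?K x y = 0" if "y \<in> nbrs x - F" for y
      using u0[of y] that by (simp only: Diff_iff) simp
  qed simp
  have r: "(\<Sum>y\<in>nbrs x. ?K y x) = (\<Sum>y\<in>F. ?K y x)" if "x \<in> F" for x
  proof (cases "u x = 0")
    case False
    then have "nbrs x \<subseteq> F" by (auto simp: F_def A_def neighbourhood_def)
    moreover have "?K y x = 0" if "y \<notin> nbrs x" for y
      using b_zero[OF that] b_sym[of x y] by simp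
    ultimately show ?thesis by (intro sum.mono_neutral_left F) auto
  qed simp
  have "l2_inner \<mu> (Lap u) v = (\<Sum>x\<in>F. complex_of_real (\<mu> x) * Lap u x * cnj (v x))"
    by (rule l2_inner_finite[OF F(1)]) (use Lap_zero_outside[OF A] in \<open>simp add: F_def\<close>)
  also have "\<dots> = (\<Sum>x\<in>F. (\<Sum>y\<in>nbrs x. complex_of_real (b x y) * u x) * cnj (v x)) -
      (\<Sum>x\<in>F. \<Sum>y\<in>nbrs x. ?K x y)"
    by (simp add: mu_Lap left_diff_distrib sum_subtractf sum_distrib_right)
  also have "(\<Sum>x\<in>F. \<Sum>y\<in>nbrs x. ?K x y) = (\<Sum>x\<in>F. \<Sum>y\<in>F. ?K y x)"
    unfolding l by (rule sum.swap)
  also have "\<dots> = (\<Sum>x\<in>F. \<Sum>y\<in>nbrs x. ?K y x)"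
    by (rule sum.cong[OF refl]) (simp only: r)
  also have "(\<Sum>x\<in>F. (\<Sum>y\<in>nbrs x. complex_of_real (b x y) * u x) * cnj (v x)) -
      (\<Sum>x\<in>F. \<Sum>y\<in>nbrs x. ?K y x) = (\<Sum>x\<in>F. complex_of_real (\<mu> x) * u x * cnj (Lap v x))"
    unfolding sum_subtractf[symmetric]
  proof (rule sum.cong[OF refl])
    fix x
    have "cnj (complex_of_real (\<mu> x) * Lap v x) =
        (\<Sum>y\<in>nbrs x. complex_of_real (b x y) * cnj (v x)) -
        (\<Sum>y\<in>nbrs x. complex_of_real (b x y) * cnj (phase x y) * cnj (v y))"
      unfolding mu_Lap by simp
    also have "(\<Sum>y\<in>nbrs x. complex_of_real (b x y) * cnj (phase x y) * cnj (v y)) =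
        (\<Sum>y\<in>nbrs x. complex_of_real (b y x) * phase y x * cnj (v y))"
      by (rule sum.cong[OF refl]) (simp only: cnj_phase b_sym)
    finally have e: "complex_of_real (\<mu> x) * cnj (Lap v x) =
        (\<Sum>y\<in>nbrs x. complex_of_real (b x y) * cnj (v x)) -
        (\<Sum>y\<in>nbrs x. complex_of_real (b y x) * phase y x * cnj (v y))"
      by simp
    have "complex_of_real (\<mu> x) * u x * cnj (Lap v x) = u x * (complex_of_real (\<mu> x) * cnj (Lap v x))"
      by simp
    also have "\<dots> = (\<Sum>y\<in>nbrs x. complex_of_real (b x y) * u x) * cnj (v x) -
        (\<Sum>y\<in>nbrs x. ?K y x)"
      unfolding e right_diff_distrib sum_distrib_left sum_distrib_right
      by (intro arg_cong2[where f = minus] sum.cong) (simp_all add: algebra_simps)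
    finally show "(\<Sum>y\<in>nbrs x. complex_of_real (b x y) * u x) * cnj (v x) -
        (\<Sum>y\<in>nbrs x. ?K y x) = complex_of_real (\<mu> x) * u x * cnj (Lap v x)"
      by simp
  qed
  also have "\<dots> = l2_inner \<mu> u (Lap v)"
    by (rule l2_inner_finite[OF F(1) u0, symmetric])
  finally show ?thesis .
qed

lemma formal_H_green:
  assumes "fin_supp u"
  shows "l2_inner \<mu> (formal_H u) v = l2_inner \<mu> u (formal_H v)"
proof -
  have L: "fin_supp (Lap (Lap u))" and L': "fin_supp (Lap u)" by (intro fin_supp_Lap assms)+
  have Wu: "fin_supp (\<lambda>x. complex_of_real (W x) * u x)"
    using assms unfolding fin_supp_def by (rule rev_finite_subset) auto
  have "l2_inner \<mu> (formal_H u) v =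
      l2_inner \<mu> (Lap (Lap u)) v + l2_inner \<mu> (\<lambda>x. complex_of_real (W x) * u x) v"
    using infsum_add[OF summable_inner_fin_supp[OF L, of \<mu> v] summable_inner_fin_supp[OF Wu, of \<mu> v]]
    by (simp add: l2_inner_def formal_H_def algebra_simps)
  also have "l2_inner \<mu> (Lap (Lap u)) v = l2_inner \<mu> u (Lap (Lap v))"
    by (simp only: Lap_green[OF L'] Lap_green[OF assms])
  also have "\<dots> + l2_inner \<mu> (\<lambda>x. complex_of_real (W x) * u x) v = l2_inner \<mu> u (formal_H v)"
    using infsum_add[OF summable_inner_fin_supp[OF assms, of \<mu> "Lap (Lap v)"]
        summable_inner_fin_supp[OF assms, of \<mu> "\<lambda>x. complex_of_real (W x) * v x"]]
    by (simp add: l2_inner_def formal_H_def algebra_simps)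
  finally show ?thesis .
qed

text \<open>Testing the adjoint relation against the indicator of one vertex determines
  \<open>w\<close> there; the converse is Green's formula. The adjoint is thus the maximal
  operator.\<close>

lemma op_adjoint_core: "op_adjoint \<mu> core = {(v, formal_H v) | v. in_l2 \<mu> v \<and> in_l2 \<mu> (formal_H v)}"
proof (intro equalityI subsetI)
  fix z assume "z \<in> op_adjoint \<mu> core"
  then obtain v w where z: "z = (v, w)" and vw: "in_l2 \<mu> v" "in_l2 \<mu> w"
    and adj: "\<And>u. fin_supp u \<Longrightarrow> l2_inner \<mu> (formal_H u) v = l2_inner \<mu> u w"
    by (auto simp: op_adjoint_def core_eq)
  have "w x = formal_H v x" for x
  proof -
    define u :: "'v \<Rightarrow> complex" where "u = (\<lambda>y. if y = x then 1 else 0)"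
    have u: "fin_supp u" by (simp add: fin_supp_def u_def)
    have i: "l2_inner \<mu> u g = complex_of_real (\<mu> x) * cnj (g x)" for g
      by (subst l2_inner_finite[where F = "{x}"]) (auto simp: u_def)
    show ?thesis
      using adj[OF u] m_pos[of x] unfolding formal_H_green[OF u] i by simp
  qed
  then have "w = formal_H v" by auto
  then show "z \<in> {(v, formal_H v) | v. in_l2 \<mu> v \<and> in_l2 \<mu> (formal_H v)}"
    using z vw by auto
qed (auto simp: op_adjoint_def core_eq formal_H_green)

lemma Lap_add: "Lap (\<lambda>x. u x + v x) x = Lap u x + Lap v x"
  unfolding mag_lap_def distrib_left[symmetric] sum.distrib[symmetric]
  by (intro arg_cong2[where f = times] sum.cong refl) (simp add: algebra_simps)

lemma Lap_scale: "Lap (\<lambda>x. c * u x) x = c * Lap u x"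
  unfolding mag_lap_def sum_distrib_left
  by (intro sum.cong refl) (simp add: algebra_simps)

lemma formal_H_add: "formal_H (\<lambda>x. u x + v x) x = formal_H u x + formal_H v x"
proof -
  have e: "Lap (\<lambda>x. u x + v x) = (\<lambda>x. Lap u x + Lap v x)" by (simp add: Lap_add fun_eq_iff)
  show ?thesis by (simp add: formal_H_def e Lap_add algebra_simps)
qed

lemma formal_H_scale: "formal_H (\<lambda>x. c * u x) x = c * formal_H u x"
proof -
  have e: "Lap (\<lambda>x. c * u x) = (\<lambda>x. c * Lap u x)" by (simp add: Lap_scale fun_eq_iff)
  show ?thesis by (simp add: formal_H_def e Lap_scale algebra_simps)
qed

text \<open>By local finiteness the value at x depends on finitely many values of the function, so
  pointwise convergence is enough.\<close>

lemma Lap_tendsto: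
  assumes "\<And>x. (\<lambda>n. s n x) \<longlonglongrightarrow> u x"
  shows "(\<lambda>n. Lap (s n) x) \<longlonglongrightarrow> Lap u x"
  unfolding mag_lap_def by (intro tendsto_intros assms)

lemma formal_H_tendsto:
  assumes "\<And>x. (\<lambda>n. s n x) \<longlonglongrightarrow> u x"
  shows "(\<lambda>n. formal_H (s n) x) \<longlonglongrightarrow> formal_H u x"
  unfolding formal_H_def by (intro tendsto_intros assms Lap_tendsto)

text \<open>Norm limits are pointwise limits, and \<open>formal_H\<close> respects these, so every
  limit pair still lies on the graph of \<open>formal_H\<close>.\<close>

lemma op_closure_core_subset: "op_closure \<mu> core \<subseteq> op_adjoint \<mu> core"
proof
  fix z assume "z \<in> op_closure \<mu> core"
  then obtain u f s where z: "z = (u, f)" and uf: "in_l2 \<mu> u" "in_l2 \<mu> f"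
    and s: "\<And>n. s n \<in> core"
    and l1: "(\<lambda>n. l2_norm \<mu> (\<lambda>x. fst (s n) x - u x)) \<longlonglongrightarrow> 0"
    and l2: "(\<lambda>n. l2_norm \<mu> (\<lambda>x. snd (s n) x - f x)) \<longlonglongrightarrow> 0"
    by (auto simp: op_closure_def)
  have fs: "fin_supp (fst (s n))" and H: "snd (s n) = formal_H (fst (s n))" for n
    using s[of n] by (auto simp: core_eq)
  have p1: "(\<lambda>n. fst (s n) x) \<longlonglongrightarrow> u x" for x
    by (rule l2_tendsto_pointwise[OF _ uf(1) l1]) (intro fin_supp_in_l2 fs)
  have p2: "(\<lambda>n. snd (s n) x) \<longlonglongrightarrow> f x" for x
    by (rule l2_tendsto_pointwise[OF _ uf(2) l2]) (unfold H, intro fin_supp_in_l2 fin_supp_formal_H fs)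
  have "formal_H u x = f x" for x
    using LIMSEQ_unique[OF formal_H_tendsto[OF p1] p2[unfolded H]] .
  then have "f = formal_H u" by auto
  then show "z \<in> op_adjoint \<mu> core" using z uf by (auto simp: op_adjoint_core)
qed

text \<open>The adjoint relation is continuous in the pair \<open>(u, f)\<close>, hence extends to
  limits; constant sequences give the other inclusion.\<close>

lemma op_adjoint_closure: "op_adjoint \<mu> (op_closure \<mu> core) = op_adjoint \<mu> core"
proof (intro equalityI subsetI)
  have "core \<subseteq> op_closure \<mu> core"
  proof
    fix z assume z: "z \<in> core"
    then have "in_l2 \<mu> (fst z)" "in_l2 \<mu> (snd z)"
      by (auto simp: core_eq intro!: fin_supp_in_l2 fin_supp_formal_H)
    moreover have "l2_norm \<mu> (\<lambda>x. 0) = 0" by (simp add: l2_norm_def)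
    ultimately show "z \<in> op_closure \<mu> core"
      using z by (cases z) (auto simp: op_closure_def intro!: exI[of _ "\<lambda>n. z"])
  qed
  then show "z \<in> op_adjoint \<mu> core" if "z \<in> op_adjoint \<mu> (op_closure \<mu> core)" for z
    using that unfolding op_adjoint_def by blast
next
  fix z assume "z \<in> op_adjoint \<mu> core"
  then obtain v w where z: "z = (v, w)" and vw: "in_l2 \<mu> v" "in_l2 \<mu> w"
    and adj: "\<And>u f. (u, f) \<in> core \<Longrightarrow> l2_inner \<mu> f v = l2_inner \<mu> u w"
    by (fastforce simp: op_adjoint_def)
  have "l2_inner \<mu> f v = l2_inner \<mu> u w" if uf: "(u, f) \<in> op_closure \<mu> core" for u f
  proof -
    from uf obtain s where ufl: "in_l2 \<mu> u" "in_l2 \<mu> f"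
      and s: "\<And>n. s n \<in> core"
      and l1: "(\<lambda>n. l2_norm \<mu> (\<lambda>x. fst (s n) x - u x)) \<longlonglongrightarrow> 0"
      and l2: "(\<lambda>n. l2_norm \<mu> (\<lambda>x. snd (s n) x - f x)) \<longlonglongrightarrow> 0"
      by (auto simp: op_closure_def)
    have "in_l2 \<mu> (fst (s n))" "in_l2 \<mu> (snd (s n))" for n
      using s[of n] by (auto simp: core_eq intro!: fin_supp_in_l2 fin_supp_formal_H)
    then have "(\<lambda>n. l2_inner \<mu> (fst (s n)) w) \<longlonglongrightarrow> l2_inner \<mu> u w"
      "(\<lambda>n. l2_inner \<mu> (snd (s n)) v) \<longlonglongrightarrow> l2_inner \<mu> f v"
      by (auto intro!: l2_inner_tendsto ufl vw l1 l2)
    moreover have "l2_inner \<mu> (snd (s n)) v = l2_inner \<mu> (fst (s n)) w" for n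
      by (rule adj) (simp add: s)
    ultimately show ?thesis using LIMSEQ_unique by auto
  qed
  then show "z \<in> op_adjoint \<mu> (op_closure \<mu> core)"
    using z vw by (auto simp: op_adjoint_def)
qed

end

section \<open>Pairs of square summable functions as functions on a disjoint sum\<close>

lemma summable_on_sum_type:
  fixes f :: "'a + 'b \<Rightarrow> 'c::{topological_comm_monoid_add, t2_space}"
  assumes "(\<lambda>x. f (Inl x)) summable_on UNIV" "(\<lambda>x. f (Inr x)) summable_on UNIV"
  shows "f summable_on UNIV"
    and "infsum f UNIV = infsum (\<lambda>x. f (Inl x)) UNIV + infsum (\<lambda>x. f (Inr x)) UNIV"
proof -
  have s: "f summable_on range Inl" "f summable_on range Inr"
    using assms by (simp_all add: summable_on_reindex o_def)
  have U: "(UNIV :: ('a + 'b) set) = range Inl \<union> range Inr"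
    by (rule UNIV_sum)
  show "f summable_on UNIV"
    unfolding U by (rule summable_on_Un_disjoint[OF s]) auto
  show "infsum f UNIV = infsum (\<lambda>x. f (Inl x)) UNIV + infsum (\<lambda>x. f (Inr x)) UNIV"
    unfolding U by (subst infsum_Un_disjoint[OF s]) (auto simp: infsum_reindex o_def)
qed

lemma weight_case_sum: "weight \<mu> \<Longrightarrow> weight (case_sum \<mu> \<mu>)"
  by (auto simp: weight_def split: sum.split)

lemma in_l2_case_sum:
  "in_l2 (case_sum \<mu> \<mu>) f \<longleftrightarrow> in_l2 \<mu> (\<lambda>x. f (Inl x)) \<and> in_l2 \<mu> (\<lambda>x. f (Inr x))"
proof (intro iffI conjI)
  assume "in_l2 (case_sum \<mu> \<mu>) f"
  then have s: "(\<lambda>x. case_sum \<mu> \<mu> x * (cmod (f x))\<^sup>2) summable_on UNIV"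
    by (simp add: in_l2_def)
  from summable_on_subset_banach[OF s, where B = "range Inl"] show "in_l2 \<mu> (\<lambda>x. f (Inl x))"
    by (simp add: in_l2_def summable_on_reindex o_def)
  from summable_on_subset_banach[OF s, where B = "range Inr"] show "in_l2 \<mu> (\<lambda>x. f (Inr x))"
    by (simp add: in_l2_def summable_on_reindex o_def)
next
  assume "in_l2 \<mu> (\<lambda>x. f (Inl x)) \<and> in_l2 \<mu> (\<lambda>x. f (Inr x))"
  then show "in_l2 (case_sum \<mu> \<mu>) f"
    unfolding in_l2_def by (intro summable_on_sum_type) auto
qed

lemma sq_norm_case_sum:
  assumes "in_l2 (case_sum \<mu> \<mu>) f"
  shows "sq_norm (case_sum \<mu> \<mu>) f = sq_norm \<mu> (\<lambda>x. f (Inl x)) + sq_norm \<mu> (\<lambda>x. f (Inr x))"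
proof -
  have "in_l2 \<mu> (\<lambda>x. f (Inl x))" "in_l2 \<mu> (\<lambda>x. f (Inr x))"
    using assms by (simp_all add: in_l2_case_sum)
  then show ?thesis
    unfolding in_l2_def sq_norm_def by (subst summable_on_sum_type) auto
qed

lemma (in weight) l2_inner_case_sum:
  assumes "in_l2 (case_sum m m) f" "in_l2 (case_sum m m) g"
  shows "l2_inner (case_sum m m) f g =
    l2_inner m (\<lambda>x. f (Inl x)) (\<lambda>x. g (Inl x)) + l2_inner m (\<lambda>x. f (Inr x)) (\<lambda>x. g (Inr x))"
  using assms summable_inner unfolding in_l2_case_sum l2_inner_def
  by (subst summable_on_sum_type) auto

section \<open>Reduction of essential self-adjointness to the absence of eigenvectors\<close>

context magnetic_graph
begin

lemma op_adjoint_core_iff: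
  "(v, w) \<in> op_adjoint \<mu> core \<longleftrightarrow> in_l2 \<mu> v \<and> in_l2 \<mu> w \<and> w = formal_H v"
  by (auto simp: op_adjoint_core)

text \<open>The orthogonal complement of the graph of the operator inside the graph of its adjoint
  consists of pairs \<open>(z, H z)\<close> with \<open>H (H z) = - z\<close>, and such \<open>z\<close> split into eigenvectors
  \<open>z \<mp> \<i> H z\<close> of eigenvalue \<open>\<plusminus>\<i>\<close>.\<close>

lemma op_adjoint_subset_closure:
  assumes no_eigenvector: "\<And>u c. in_l2 \<mu> u \<Longrightarrow> c = \<i> \<or> c = - \<i> \<Longrightarrow> (\<And>x. formal_H u x = c * u x) \<Longrightarrow> u = (\<lambda>_. 0)"
  shows "op_adjoint \<mu> core \<subseteq> op_closure \<mu> core"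
proof
  fix y assume "y \<in> op_adjoint \<mu> core"
  then obtain v where y: "y = (v, formal_H v)" and v: "in_l2 \<mu> v" "in_l2 \<mu> (formal_H v)"
    by (auto simp: op_adjoint_core)
  let ?m = "case_sum \<mu> \<mu>"
  interpret sum: weight ?m
    by (rule weight_case_sum) unfold_locales
  \<comment> \<open>The graph of the operator on the core, encoded as a subspace of the square
    summable functions on two copies of the vertices.\<close>
  define S where "S = {case_sum u (formal_H u) | u. fin_supp u}"
  have add: "(\<lambda>x. f x + g x) \<in> S" if "f \<in> S" "g \<in> S" for f g
  proof -
    from that obtain u u' where u: "f = case_sum u (formal_H u)" "g = case_sum u' (formal_H u')"
      "fin_supp u" "fin_supp u'" by (auto simp: S_def)
    have "finite ({x. u x \<noteq> 0} \<union> {x. u' x \<noteq> 0})" using u by (simp add: fin_supp_def)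
    then have "fin_supp (\<lambda>x. u x + u' x)"
      unfolding fin_supp_def by (rule rev_finite_subset) auto
    moreover have "(\<lambda>x. f x + g x) = case_sum (\<lambda>x. u x + u' x) (formal_H (\<lambda>x. u x + u' x))"
      using u by (auto simp: fun_eq_iff formal_H_add split: sum.split)
    ultimately show ?thesis unfolding S_def by blast
  qed
  have scale: "(\<lambda>x. c * f x) \<in> S" if "f \<in> S" for f c
  proof -
    from that obtain u where u: "f = case_sum u (formal_H u)" "fin_supp u" by (auto simp: S_def)
    then have "fin_supp (\<lambda>x. c * u x)"
      unfolding fin_supp_def by (elim rev_finite_subset) auto
    moreover have "(\<lambda>x. c * f x) = case_sum (\<lambda>x. c * u x) (formal_H (\<lambda>x. c * u x))"
      using u by (auto simp: fun_eq_iff formal_H_scale split: sum.split)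
    ultimately show ?thesis unfolding S_def by blast
  qed
  have zero: "(\<lambda>_. 0) \<in> S"
  proof -
    have "fin_supp (\<lambda>_. 0)" by (simp add: fin_supp_def)
    then have "case_sum (\<lambda>_. 0) (formal_H (\<lambda>_. 0)) \<in> S" unfolding S_def by blast
    from scale[OF this, of 0] show ?thesis by simp
  qed
  have SL: "in_l2 ?m f" if "f \<in> S" for f
    using that by (auto simp: S_def in_l2_case_sum intro!: fin_supp_in_l2 fin_supp_formal_H)
  have w: "in_l2 ?m (case_sum v (formal_H v))"
    using v by (simp add: in_l2_case_sum)
  obtain s p where s: "\<forall>n::nat. s n \<in> S" and p: "in_l2 ?m p"
    and lim: "(\<lambda>n. l2_norm ?m (\<lambda>x. s n x - p x)) \<longlonglongrightarrow> 0"
    and orth: "\<forall>g\<in>S. l2_inner ?m g (\<lambda>x. case_sum v (formal_H v) x - p x) = 0"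
    by (rule sum.l2_projection[OF SL zero add scale w])
  have d: "in_l2 ?m (\<lambda>x. s n x - p x)" for n
    by (intro sum.in_l2_diff SL s[rule_format] p)
  \<comment> \<open>Each component norm is at most the joint norm, so the projection
    \<open>p\<close> is a limit of the graph in both components and lies in the closure.\<close>
  have n: "l2_norm \<mu> (\<lambda>x. s n (Inl x) - p (Inl x)) \<le> l2_norm ?m (\<lambda>x. s n x - p x)"
    "l2_norm \<mu> (\<lambda>x. s n (Inr x) - p (Inr x)) \<le> l2_norm ?m (\<lambda>x. s n x - p x)" for n
    unfolding l2_norm_eq_sqrt sq_norm_case_sum[OF d] by (auto intro!: real_sqrt_le_mono)
  have n0: "0 \<le> l2_norm \<mu> f" for f by (simp add: l2_norm_eq_sqrt)
  have l1: "(\<lambda>n. l2_norm \<mu> (\<lambda>x. s n (Inl x) - p (Inl x))) \<longlonglongrightarrow> 0"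
    by (rule tendsto_sandwich[OF _ _ tendsto_const lim]) (use n n0 in auto)
  have l2: "(\<lambda>n. l2_norm \<mu> (\<lambda>x. s n (Inr x) - p (Inr x))) \<longlonglongrightarrow> 0"
    by (rule tendsto_sandwich[OF _ _ tendsto_const lim]) (use n n0 in auto)
  define p1 p2 where "p1 = (\<lambda>x. p (Inl x))" and "p2 = (\<lambda>x. p (Inr x))"
  have pl: "in_l2 \<mu> p1" "in_l2 \<mu> p2"
    using p by (auto simp: in_l2_case_sum p1_def p2_def)
  have "((\<lambda>x. s n (Inl x)), (\<lambda>x. s n (Inr x))) \<in> core" for n
    using s[rule_format, of n] by (auto simp: S_def core_eq)
  then have cl: "(p1, p2) \<in> op_closure \<mu> core"
    using l1 l2 pl unfolding op_closure_def p1_def p2_def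
    by (auto intro!: exI[of _ "\<lambda>n. ((\<lambda>x. s n (Inl x)), (\<lambda>x. s n (Inr x)))"])
  then have p2: "p2 = formal_H p1"
    using op_closure_core_subset by (auto simp: op_adjoint_core_iff)
  define z1 z2 where "z1 = (\<lambda>x. v x - p1 x)" and "z2 = (\<lambda>x. formal_H v x - p2 x)"
  have zl: "in_l2 \<mu> z1" "in_l2 \<mu> z2"
    unfolding z1_def z2_def by (intro in_l2_diff v pl)+
  have H1: "formal_H z1 x = z2 x" for x
    using formal_H_add[of v "\<lambda>x. - 1 * p1 x" x] formal_H_scale[of "- 1" p1 x]
    by (simp add: z1_def z2_def p2)
  \<comment> \<open>Orthogonality of the residual to \<open>(u, H u)\<close> says that the pairings
    of \<open>u\<close> with \<open>z1\<close> and of \<open>H u\<close> with \<open>z2\<close>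
    cancel, which is the adjoint relation for \<open>z2\<close> with value
    \<open>- z1\<close>.\<close>
  have "(z2, (\<lambda>x. - z1 x)) \<in> op_adjoint \<mu> core"
    unfolding op_adjoint_def core_eq
  proof (clarsimp, intro conjI zl in_l2_minus allI impI)
    fix u :: "'v \<Rightarrow> complex" assume u: "fin_supp u"
    then have uS: "case_sum u (formal_H u) \<in> S" by (auto simp: S_def)
    have "l2_inner \<mu> u z1 + l2_inner \<mu> (formal_H u) z2 = 0"
      using bspec[OF orth uS] l2_inner_case_sum[OF SL[OF uS] sum.in_l2_diff[OF w p]]
      by (simp add: z1_def z2_def p1_def p2_def)
    moreover have "l2_inner \<mu> u (\<lambda>x. - z1 x) = - l2_inner \<mu> u z1"
      using l2_inner_scale_right[of u "- 1" z1] by simp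
    ultimately show "l2_inner \<mu> (formal_H u) z2 = l2_inner \<mu> u (\<lambda>x. - z1 x)"
      by (metis add_left_imp_eq add.right_inverse)
  qed
  then have H2: "formal_H z2 x = - z1 x" for x
    unfolding op_adjoint_core_iff by metis
  \<comment> \<open>Since \<open>c * c = - 1\<close>, \<open>H\<close> maps
    \<open>z1 - c * z2\<close> to \<open>z2 + c * z1\<close>, which is c times that vector. Using
    both signs of c isolates \<open>z1\<close> and \<open>z2\<close>.\<close>
  have eig: "z1 x - c * z2 x = 0" if c: "c = \<i> \<or> c = - \<i>" for c x
  proof -
    have "(\<lambda>x. z1 x + (- c) * z2 x) = (\<lambda>_. 0)"
    proof (rule no_eigenvector[OF _ c])
      show "in_l2 \<mu> (\<lambda>x. z1 x + (- c) * z2 x)" by (intro in_l2_add in_l2_scale zl)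
      have "c * c = - 1" using c by auto
      then show "formal_H (\<lambda>x. z1 x + (- c) * z2 x) x = c * (z1 x + (- c) * z2 x)" for x
        unfolding formal_H_add formal_H_scale H1 H2
        by (simp add: algebra_simps mult.assoc[symmetric])
    qed
    from fun_cong[OF this, of x] show ?thesis by simp
  qed
  have "z1 x = 0 \<and> z2 x = 0" for x
    using eig[of \<i> x] eig[of "- \<i>" x] by auto
  then have "p1 = v" "p2 = formal_H v"
    by (auto simp: z1_def z2_def fun_eq_iff)
  then show "y \<in> op_closure \<mu> core" using cl y by simp
qed

lemma ess_self_adjoint_if_no_eigenvector:
  assumes "\<And>u c. in_l2 \<mu> u \<Longrightarrow> c = \<i> \<or> c = - \<i> \<Longrightarrow> (\<And>x. formal_H u x = c * u x) \<Longrightarrow> u = (\<lambda>_. 0)"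
  shows "ess_self_adjoint \<mu> core"
  unfolding ess_self_adjoint_def self_adjoint_op_def op_adjoint_closure
  by (intro equalityI op_adjoint_subset_closure op_closure_core_subset) (rule assms)

end

section \<open>The cutoff estimate\<close>

context magnetic_graph
begin

text \<open>Schur test for the kernel \<open>b x y * \<eta> x\<close>. This kernel is not symmetric,
  since \<open>\<eta>\<close> is taken at x only, so rows and columns need separate bounds.\<close>

lemma Schur_bound:
  assumes u: "in_l2 \<mu> u" and F: "finite F" and \<eta>: "\<And>x. 0 \<le> \<eta> x" and \<epsilon>: "0 \<le> \<epsilon>"
    and row: "\<And>x. (\<Sum>y\<in>nbrs x. b x y * \<eta> x) \<le> \<epsilon> * \<mu> x"
    and col: "\<And>y. (\<Sum>x\<in>nbrs y. b y x * \<eta> x) \<le> \<epsilon> * \<mu> y"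
  shows "(\<Sum>x\<in>F. \<mu> x * (\<eta> x / \<mu> x * (\<Sum>y\<in>nbrs x. b x y * cmod (u y)))\<^sup>2) \<le> \<epsilon>\<^sup>2 * sq_norm \<mu> u"
proof -
  let ?K = "\<lambda>x y. b x y * \<eta> x * (cmod (u y))\<^sup>2"
  define G where "G = neighbourhood F"
  have G: "finite G" using F by (simp add: G_def finite_neighbourhood)
  have point: "\<mu> x * (\<eta> x / \<mu> x * (\<Sum>y\<in>nbrs x. b x y * cmod (u y)))\<^sup>2 \<le> \<epsilon> * (\<Sum>y\<in>G. ?K x y)"
    if x: "x \<in> F" for x
  proof -
    let ?A = "\<Sum>y\<in>nbrs x. b x y" and ?B = "\<Sum>y\<in>nbrs x. b x y * (cmod (u y))\<^sup>2"
    \<comment> \<open>Splitting \<open>b\<close> into two square roots lets Cauchy-Schwarz leave one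
      full factor \<open>b\<close> in each sum.\<close>
    have "(\<Sum>y\<in>nbrs x. b x y * cmod (u y))\<^sup>2 = (\<Sum>y\<in>nbrs x. sqrt (b x y) * (sqrt (b x y) * cmod (u y)))\<^sup>2"
      using b_nonneg by (simp add: mult.assoc[symmetric])
    also have "\<dots> \<le> (\<Sum>y\<in>nbrs x. (sqrt (b x y))\<^sup>2) * (\<Sum>y\<in>nbrs x. (sqrt (b x y) * cmod (u y))\<^sup>2)"
      by (rule Cauchy_Schwarz_ineq_sum)
    also have "\<dots> = ?A * ?B"
      using b_nonneg by (simp add: power_mult_distrib)
    finally have CS: "(\<Sum>y\<in>nbrs x. b x y * cmod (u y))\<^sup>2 \<le> ?A * ?B" .
    have B0: "0 \<le> ?B" using b_nonneg by (auto intro!: sum_nonneg)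
    have "\<mu> x * (\<eta> x / \<mu> x * (\<Sum>y\<in>nbrs x. b x y * cmod (u y)))\<^sup>2
        = (\<eta> x)\<^sup>2 / \<mu> x * (\<Sum>y\<in>nbrs x. b x y * cmod (u y))\<^sup>2"
      using m_pos[of x] by (simp add: power_mult_distrib power_divide power2_eq_square)
    also have "\<dots> \<le> (\<eta> x)\<^sup>2 / \<mu> x * (?A * ?B)"
      by (rule mult_left_mono[OF CS]) simp
    \<comment> \<open>One factor \<open>\<eta> x\<close> completes the row sum; the other stays with
      the values of \<open>u\<close> and completes the column sum after the order of summation is
      exchanged.\<close>
    also have "\<dots> = ((\<Sum>y\<in>nbrs x. b x y * \<eta> x) / \<mu> x) * (\<eta> x * ?B)"
      by (simp add: sum_distrib_right[symmetric] power2_eq_square)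
    also have "\<dots> \<le> \<epsilon> * (\<eta> x * ?B)"
      using row[of x] m_pos[of x] B0 \<eta>[of x] by (intro mult_right_mono) (auto simp: divide_le_eq)
    also have "\<eta> x * ?B = (\<Sum>y\<in>nbrs x. ?K x y)"
      by (simp add: sum_distrib_left algebra_simps)
    also have "\<dots> = (\<Sum>y\<in>G. ?K x y)"
      by (rule sum.mono_neutral_left[OF G]) (use x b_zero in \<open>auto simp: G_def neighbourhood_def\<close>)
    finally show ?thesis .
  qed
  have "(\<Sum>x\<in>F. \<mu> x * (\<eta> x / \<mu> x * (\<Sum>y\<in>nbrs x. b x y * cmod (u y)))\<^sup>2) \<le> (\<Sum>x\<in>F. \<epsilon> * (\<Sum>y\<in>G. ?K x y))"
    by (rule sum_mono) (rule point)
  also have "\<dots> = \<epsilon> * (\<Sum>y\<in>G. \<Sum>x\<in>F. ?K x y)"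
    by (subst sum.swap) (simp add: sum_distrib_left)
  also have "\<dots> \<le> \<epsilon> * (\<Sum>y\<in>G. \<epsilon> * (\<mu> y * (cmod (u y))\<^sup>2))"
  proof (intro mult_left_mono[OF _ \<epsilon>] sum_mono)
    fix y
    have "(\<Sum>x\<in>F. b x y * \<eta> x) \<le> (\<Sum>x\<in>F \<union> nbrs y. b x y * \<eta> x)"
      by (rule sum_mono2) (use F deg_fin b_nonneg \<eta> in auto)
    also have "\<dots> = (\<Sum>x\<in>nbrs y. b x y * \<eta> x)"
    proof (rule sum.mono_neutral_right)
      show "\<forall>x\<in>F \<union> nbrs y - nbrs y. b x y * \<eta> x = 0"
        using b_zero[of _ y] b_sym[of _ y] by simp
    qed (use F deg_fin in auto)
    also have "\<dots> = (\<Sum>x\<in>nbrs y. b y x * \<eta> x)" by (simp only: b_sym)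
    also have "\<dots> \<le> \<epsilon> * \<mu> y" by (rule col)
    finally have "(\<Sum>x\<in>F. b x y * \<eta> x) * (cmod (u y))\<^sup>2 \<le> \<epsilon> * \<mu> y * (cmod (u y))\<^sup>2"
      by (rule mult_right_mono) simp
    then show "(\<Sum>x\<in>F. ?K x y) \<le> \<epsilon> * (\<mu> y * (cmod (u y))\<^sup>2)"
      by (simp add: sum_distrib_right mult.assoc)
  qed
  also have "\<dots> = \<epsilon>\<^sup>2 * (\<Sum>y\<in>G. \<mu> y * (cmod (u y))\<^sup>2)"
    by (simp add: sum_distrib_left power2_eq_square mult.assoc)
  also have "\<dots> \<le> \<epsilon>\<^sup>2 * sq_norm \<mu> u"
    by (rule mult_left_mono[OF finite_sum_le_sq_norm[OF u G]]) simp
  finally show ?thesis .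
qed

text \<open>The difference of the squares of the cutoff at x and y is \<open>2 * \<phi> x * (\<phi>
  x - \<phi> y) - (\<phi> x - \<phi> y)\<^sup>2\<close>: a first order commutator that keeps a
  factor \<open>\<phi> x\<close>, and a second order remainder without it.\<close>

lemma Lap_cutoff_square:
  fixes \<phi> :: "'v \<Rightarrow> real"
  shows "Lap (\<lambda>x. complex_of_real ((\<phi> x)\<^sup>2) * u x) x =
    complex_of_real ((\<phi> x)\<^sup>2) * Lap u x
    + 2 * complex_of_real (\<phi> x) * ((1 / complex_of_real (\<mu> x)) *
        (\<Sum>y\<in>nbrs x. complex_of_real (b x y * (\<phi> x - \<phi> y)) * phase x y * u y))
    - (1 / complex_of_real (\<mu> x)) *
        (\<Sum>y\<in>nbrs x. complex_of_real (b x y * (\<phi> x - \<phi> y)\<^sup>2) * phase x y * u y)"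
proof -
  have "complex_of_real (b x y) * (complex_of_real ((\<phi> x)\<^sup>2) * u x - phase x y * (complex_of_real ((\<phi> y)\<^sup>2) * u y))
     = complex_of_real ((\<phi> x)\<^sup>2) * (complex_of_real (b x y) * (u x - phase x y * u y))
     + 2 * complex_of_real (\<phi> x) * (complex_of_real (b x y * (\<phi> x - \<phi> y)) * phase x y * u y)
     - complex_of_real (b x y * (\<phi> x - \<phi> y)\<^sup>2) * phase x y * u y" for y
    by (simp add: power2_eq_square algebra_simps)
  then show ?thesis
    unfolding mag_lap_def
    by (simp only: sum_subtractf sum.distrib sum_distrib_left[symmetric])
       (simp add: algebra_simps)
qed

text \<open>Here \<open>\<eta>\<close> bounds the jumps of the cutoff and \<open>\<epsilon>\<close>
  is the Schur constant of the commutator. The free parameter \<open>\<tau>\<close> balances a large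
  \<open>M\<close> against a small \<open>\<epsilon>\<close>.\<close>

lemma cutoff_estimate:
  fixes \<phi> \<eta> :: "'v \<Rightarrow> real"
  assumes u: "in_l2 \<mu> u" and c: "c = \<i> \<or> c = - \<i>" and eig: "\<And>x. formal_H u x = c * u x"
    and \<phi>: "finite {x. \<phi> x \<noteq> 0}" "\<And>x. \<bar>\<phi> x\<bar> \<le> 1"
    and \<phi>_\<eta>: "\<And>x y. 0 < b x y \<Longrightarrow> \<bar>\<phi> x - \<phi> y\<bar> \<le> \<eta> x"
    and \<eta>: "\<And>x. 0 \<le> \<eta> x" and \<epsilon>: "0 \<le> \<epsilon>"
    and row: "\<And>x. (\<Sum>y\<in>nbrs x. b x y * \<eta> x) \<le> \<epsilon> * \<mu> x"
    and col: "\<And>y. (\<Sum>x\<in>nbrs y. b y x * \<eta> x) \<le> \<epsilon> * \<mu> y"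
    and W: "\<And>x. \<phi> x \<noteq> 0 \<Longrightarrow> - M \<le> W x" and M: "0 \<le> M" and \<tau>: "0 < \<tau>"
  shows "\<mu> z * (\<phi> z)\<^sup>2 * (cmod (u z))\<^sup>2 \<le> (\<tau> * (2 * M + 10 * \<epsilon>\<^sup>2) + (1 / \<tau> + 3) * \<epsilon>\<^sup>2) * sq_norm \<mu> u"
proof -
  define U where "U = sq_norm \<mu> u"
  define A where "A = {x. \<phi> x \<noteq> 0}"
  define F where "F = neighbourhood A"
  have F: "finite F" "A \<subseteq> F" 
    using \<phi> finite_neighbourhood by (auto simp: F_def A_def neighbourhood_def)
  define a where "a = Lap u"
  define \<psi> where "\<psi> = (\<lambda>x. complex_of_real ((\<phi> x)\<^sup>2) * u x)"
  \<comment> \<open>\<open>T\<close> majorises every commutator term: \<open>C\<close> is bounded by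
    \<open>T\<close>, \<open>E\<close> by \<open>\<eta> * T\<close>, and the Schur test bounds the
    norm of \<open>T\<close> by that of \<open>u\<close>.\<close>
  define T where "T = (\<lambda>x. \<eta> x / \<mu> x * (\<Sum>y\<in>nbrs x. b x y * cmod (u y)))"
  define C where "C = (\<lambda>x. (1 / complex_of_real (\<mu> x)) *
        (\<Sum>y\<in>nbrs x. complex_of_real (b x y * (\<phi> x - \<phi> y)) * phase x y * u y))"
  define E where "E = (\<lambda>x. (1 / complex_of_real (\<mu> x)) *
        (\<Sum>y\<in>nbrs x. complex_of_real (b x y * (\<phi> x - \<phi> y)\<^sup>2) * phase x y * u y))"
  have Lap\<psi>: "Lap \<psi> x = complex_of_real ((\<phi> x)\<^sup>2) * a x + 2 * complex_of_real (\<phi> x) * C x - E x" for x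
    unfolding \<psi>_def C_def E_def a_def by (rule Lap_cutoff_square)
  have T0: "0 \<le> T x" for x
    unfolding T_def
    by (intro mult_nonneg_nonneg divide_nonneg_nonneg sum_nonneg \<eta> b_nonneg m_nonneg norm_ge_zero)
  have ST: "(\<Sum>x\<in>F. \<mu> x * (T x)\<^sup>2) \<le> \<epsilon>\<^sup>2 * U"
    unfolding T_def U_def by (rule Schur_bound[OF u F(1) \<eta> \<epsilon> row col])
  have Su: "(\<Sum>x\<in>F. \<mu> x * (cmod (u x))\<^sup>2) \<le> U"
    unfolding U_def by (rule finite_sum_le_sq_norm[OF u F(1)])
  have Cb: "cmod (C x) \<le> T x" for x
  proof -
    have "cmod (C x) \<le> (1 / \<mu> x) * (\<Sum>y\<in>nbrs x. b x y * (\<eta> x * cmod (u y)))"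
      unfolding C_def norm_mult
    proof (rule mult_mono)
      show "cmod (\<Sum>y\<in>nbrs x. complex_of_real (b x y * (\<phi> x - \<phi> y)) * phase x y * u y)
          \<le> (\<Sum>y\<in>nbrs x. b x y * (\<eta> x * cmod (u y)))"
        by (rule sum_norm_le)
           (use \<phi>_\<eta> b_nonneg in \<open>auto simp: norm_mult abs_mult mult.assoc simp flip: of_real_diff intro!: mult_left_mono mult_right_mono\<close>)
    qed (auto simp: norm_divide)
    then show ?thesis by (simp add: T_def sum_distrib_left algebra_simps)
  qed
  have Eb: "cmod (E x) \<le> \<eta> x * T x" for x
  proof -
    have "cmod (E x) \<le> (1 / \<mu> x) * (\<Sum>y\<in>nbrs x. b x y * ((\<eta> x)\<^sup>2 * cmod (u y)))"
      unfolding E_def norm_mult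
    proof (rule mult_mono)
      show "cmod (\<Sum>y\<in>nbrs x. complex_of_real (b x y * (\<phi> x - \<phi> y)\<^sup>2) * phase x y * u y)
          \<le> (\<Sum>y\<in>nbrs x. b x y * ((\<eta> x)\<^sup>2 * cmod (u y)))"
      proof (rule sum_norm_le)
        fix y assume "y \<in> nbrs x"
        then have "(\<phi> x - \<phi> y)\<^sup>2 \<le> (\<eta> x)\<^sup>2"
          using \<phi>_\<eta>[of x y] \<eta>[of x] by (metis abs_le_square_iff abs_of_nonneg mem_Collect_eq)
        then show "cmod (complex_of_real (b x y * (\<phi> x - \<phi> y)\<^sup>2) * phase x y * u y)
            \<le> b x y * ((\<eta> x)\<^sup>2 * cmod (u y))"
          using b_nonneg[of x y]
          by (auto simp: norm_mult norm_power abs_mult mult.assoc simp flip: of_real_diff intro!: mult_left_mono mult_right_mono)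
      qed
    qed (auto simp: norm_divide)
    then show ?thesis by (simp add: T_def sum_distrib_left power2_eq_square algebra_simps)
  qed
  \<comment> \<open>\<open>E\<close> has no factor \<open>\<phi>\<close>, so its pairing with
    \<open>a\<close> cannot be absorbed into \<open>X\<close>, and \<open>a\<close> is not known to
    be square summable. Moving \<open>\<eta>\<close> from the bound on \<open>E\<close> onto
    \<open>a\<close> helps, because \<open>\<eta> * a\<close> is controlled by \<open>u\<close>
    alone through the row bound.\<close>
  have ab: "\<eta> x * cmod (a x) \<le> \<epsilon> * cmod (u x) + T x" for x
  proof -
    have "cmod (a x) \<le> (1 / \<mu> x) * (\<Sum>y\<in>nbrs x. b x y * (cmod (u x) + cmod (u y)))"
      unfolding a_def mag_lap_def norm_mult
    proof (rule mult_mono)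
      show "cmod (\<Sum>y\<in>nbrs x. complex_of_real (b x y) * (u x - phase x y * u y))
          \<le> (\<Sum>y\<in>nbrs x. b x y * (cmod (u x) + cmod (u y)))"
      proof (rule sum_norm_le)
        fix y
        have "cmod (u x - phase x y * u y) \<le> cmod (u x) + cmod (u y)"
          using norm_triangle_ineq4[of "u x" "phase x y * u y"] by (simp add: norm_mult)
        then show "cmod (complex_of_real (b x y) * (u x - phase x y * u y)) \<le> b x y * (cmod (u x) + cmod (u y))"
          using b_nonneg[of x y] by (simp add: norm_mult mult_left_mono)
      qed
    qed (auto simp: norm_divide)
    from mult_left_mono[OF this \<eta>[of x]]
    have "\<eta> x * cmod (a x) \<le> ((\<Sum>y\<in>nbrs x. b x y * \<eta> x) / \<mu> x) * cmod (u x) + T x"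
      by (simp add: T_def sum.distrib sum_distrib_left sum_distrib_right distrib_left
          add_divide_distrib sum_divide_distrib algebra_simps)
    also have "\<dots> \<le> \<epsilon> * cmod (u x) + T x"
      using row[of x] m_pos[of x] by (intro add_right_mono mult_right_mono) (auto simp: divide_le_eq)
    finally show ?thesis .
  qed
  have Sa: "(\<Sum>x\<in>F. \<mu> x * (\<eta> x * cmod (a x))\<^sup>2) \<le> 4 * \<epsilon>\<^sup>2 * U"
  proof -
    have "(\<Sum>x\<in>F. \<mu> x * (\<eta> x * cmod (a x))\<^sup>2) \<le> (\<Sum>x\<in>F. 2 * \<epsilon>\<^sup>2 * (\<mu> x * (cmod (u x))\<^sup>2) + 2 * (\<mu> x * (T x)\<^sup>2))"
    proof (rule sum_mono)
      fix x
      have "(\<eta> x * cmod (a x))\<^sup>2 \<le> (\<epsilon> * cmod (u x) + T x)\<^sup>2"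
        by (rule power_mono[OF ab]) (use \<eta> in simp)
      also have "\<dots> \<le> 2 * (\<epsilon> * cmod (u x))\<^sup>2 + 2 * (T x)\<^sup>2"
        using sum_squares_bound[of "\<epsilon> * cmod (u x)" "T x"] by (simp add: power2_sum)
      finally have "\<mu> x * (\<eta> x * cmod (a x))\<^sup>2 \<le> \<mu> x * (2 * (\<epsilon> * cmod (u x))\<^sup>2 + 2 * (T x)\<^sup>2)"
        by (rule mult_left_mono) simp
      then show "\<mu> x * (\<eta> x * cmod (a x))\<^sup>2 \<le> 2 * \<epsilon>\<^sup>2 * (\<mu> x * (cmod (u x))\<^sup>2) + 2 * (\<mu> x * (T x)\<^sup>2)"
        by (simp add: power_mult_distrib algebra_simps)
    qed
    also have "\<dots> = 2 * \<epsilon>\<^sup>2 * (\<Sum>x\<in>F. \<mu> x * (cmod (u x))\<^sup>2) + 2 * (\<Sum>x\<in>F. \<mu> x * (T x)\<^sup>2)"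
      by (simp add: sum.distrib sum_distrib_left)
    also have "\<dots> \<le> 2 * \<epsilon>\<^sup>2 * U + 2 * (\<epsilon>\<^sup>2 * U)"
      by (intro add_mono mult_left_mono Su ST) auto
    finally show ?thesis by (simp add: mult_ac)
  qed
  \<comment> \<open>\<open>X\<close> and \<open>Y\<close> are the squared norms of
    \<open>\<phi> a\<close> and \<open>\<phi> u\<close>, \<open>Z\<close> is the potential energy,
    and \<open>R\<close> collects the commutator terms.\<close>
  define X where "X = (\<Sum>x\<in>F. \<mu> x * ((\<phi> x)\<^sup>2 * (cmod (a x))\<^sup>2))"
  define Y where "Y = (\<Sum>x\<in>F. \<mu> x * ((\<phi> x)\<^sup>2 * (cmod (u x))\<^sup>2))"
  define Z where "Z = (\<Sum>x\<in>F. W x * (\<mu> x * ((\<phi> x)\<^sup>2 * (cmod (u x))\<^sup>2)))"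
  define R where "R = (\<Sum>x\<in>F. complex_of_real (\<mu> x) * (2 * complex_of_real (\<phi> x) * C x - E x) * cnj (a x))"
  have Rb: "cmod R \<le> t * X + (1 / t + 3) * \<epsilon>\<^sup>2 * U" if t: "0 < t" for t
  proof -
    have "cmod R \<le> (\<Sum>x\<in>F. t * (\<mu> x * ((\<phi> x)\<^sup>2 * (cmod (a x))\<^sup>2)) + (1 / t) * (\<mu> x * (T x)\<^sup>2)
        + (1 / 2) * (\<mu> x * (\<eta> x * cmod (a x))\<^sup>2) + (1 / 2) * (\<mu> x * (T x)\<^sup>2))"
      unfolding R_def
    proof (rule sum_norm_le)
      fix x
      define \<alpha> where "\<alpha> = \<bar>\<phi> x\<bar> * cmod (a x)"
      have "cmod (2 * complex_of_real (\<phi> x) * C x - E x) \<le> 2 * \<bar>\<phi> x\<bar> * T x + \<eta> x * T x"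
        by (rule norm_triangle_le_diff)
           (use Cb[of x] Eb[of x] in \<open>auto simp: norm_mult intro!: add_mono mult_left_mono\<close>)
      from mult_right_mono[OF this, of "cmod (a x)"]
      have 1: "cmod (2 * complex_of_real (\<phi> x) * C x - E x) * cmod (a x)
          \<le> 2 * \<alpha> * T x + (\<eta> x * cmod (a x)) * T x"
        by (simp add: \<alpha>_def algebra_simps)
      \<comment> \<open>Young's inequality with weight t: the part with \<open>\<phi> a\<close> gets
        the small factor t, to be absorbed or traded later.\<close>
      have "2 * \<alpha> * T x = 2 * (sqrt t * \<alpha>) * (T x / sqrt t)" using t by simp
      also have "\<dots> \<le> (sqrt t * \<alpha>)\<^sup>2 + (T x / sqrt t)\<^sup>2" by (rule sum_squares_bound)
      also have "\<dots> = t * \<alpha>\<^sup>2 + (1 / t) * (T x)\<^sup>2"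
        using t by (simp add: power_mult_distrib power_divide)
      finally have 2: "2 * \<alpha> * T x \<le> t * \<alpha>\<^sup>2 + (1 / t) * (T x)\<^sup>2" .
      have 3: "(\<eta> x * cmod (a x)) * T x \<le> (1 / 2) * (\<eta> x * cmod (a x))\<^sup>2 + (1 / 2) * (T x)\<^sup>2"
        using sum_squares_bound[of "\<eta> x * cmod (a x)" "T x"] by simp
      have "cmod (2 * complex_of_real (\<phi> x) * C x - E x) * cmod (a x)
          \<le> t * \<alpha>\<^sup>2 + (1 / t) * (T x)\<^sup>2 + (1 / 2) * (\<eta> x * cmod (a x))\<^sup>2 + (1 / 2) * (T x)\<^sup>2"
        using 1 2 3 by linarith
      note mult_left_mono[OF this, of "\<mu> x"]
      moreover have "cmod (complex_of_real (\<mu> x) * (2 * complex_of_real (\<phi> x) * C x - E x) * cnj (a x))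
          = \<mu> x * (cmod (2 * complex_of_real (\<phi> x) * C x - E x) * cmod (a x))"
        by (simp add: norm_mult)
      ultimately show "cmod (complex_of_real (\<mu> x) * (2 * complex_of_real (\<phi> x) * C x - E x) * cnj (a x))
        \<le> t * (\<mu> x * ((\<phi> x)\<^sup>2 * (cmod (a x))\<^sup>2)) + (1 / t) * (\<mu> x * (T x)\<^sup>2)
        + (1 / 2) * (\<mu> x * (\<eta> x * cmod (a x))\<^sup>2) + (1 / 2) * (\<mu> x * (T x)\<^sup>2)"
        by (simp add: \<alpha>_def power_mult_distrib distrib_left mult_ac)
    qed
    also have "\<dots> = t * X + (1 / t) * (\<Sum>x\<in>F. \<mu> x * (T x)\<^sup>2)
        + (1 / 2) * (\<Sum>x\<in>F. \<mu> x * (\<eta> x * cmod (a x))\<^sup>2) + (1 / 2) * (\<Sum>x\<in>F. \<mu> x * (T x)\<^sup>2)"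
      by (simp only: sum.distrib sum_distrib_left[symmetric] X_def)
    also have "\<dots> \<le> t * X + (1 / t) * (\<epsilon>\<^sup>2 * U) + (1 / 2) * (4 * \<epsilon>\<^sup>2 * U) + (1 / 2) * (\<epsilon>\<^sup>2 * U)"
      using t by (intro add_mono mult_left_mono ST Sa) auto
    also have "\<dots> \<le> t * X + (1 / t + 3) * \<epsilon>\<^sup>2 * U"
    proof -
      have "0 \<le> \<epsilon>\<^sup>2 * U" by (simp add: U_def)
      then show ?thesis by (simp add: algebra_simps)
    qed
    finally show ?thesis .
  qed
  \<comment> \<open>Green's formula for \<open>\<psi>\<close> and \<open>a\<close>: one side is
    expanded by the product rule for the cutoff, the other by the eigenvalue equation solved for
    \<open>Lap a\<close>.\<close>
  have id: "complex_of_real X + R = cnj c * complex_of_real Y - complex_of_real Z"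
  proof -
    have \<psi>0: "\<psi> x = 0" if "x \<notin> A" for x using that by (simp add: \<psi>_def A_def)
    have "l2_inner \<mu> (Lap \<psi>) a = (\<Sum>x\<in>F. complex_of_real (\<mu> x) * Lap \<psi> x * cnj (a x))"
      by (rule l2_inner_finite[OF F(1)]) (use Lap_zero_outside[OF \<psi>0] in \<open>simp add: F_def\<close>)
    also have "\<dots> = (\<Sum>x\<in>F. complex_of_real (\<mu> x * ((\<phi> x)\<^sup>2 * (cmod (a x))\<^sup>2))
        + complex_of_real (\<mu> x) * (2 * complex_of_real (\<phi> x) * C x - E x) * cnj (a x))"
      unfolding Lap\<psi> of_real_mult complex_norm_square by (simp add: algebra_simps)
    also have "\<dots> = complex_of_real X + R"
      by (simp only: sum.distrib X_def R_def of_real_sum)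
    finally have 1: "l2_inner \<mu> (Lap \<psi>) a = complex_of_real X + R" .
    have La: "Lap a x = c * u x - complex_of_real (W x) * u x" for x
      using eig[of x] by (simp add: formal_H_def a_def eq_diff_eq)
    have "l2_inner \<mu> \<psi> (Lap a) = (\<Sum>x\<in>F. complex_of_real (\<mu> x) * \<psi> x * cnj (Lap a x))"
      by (rule l2_inner_finite[OF F(1)]) (use \<psi>0 F in auto)
    also have "\<dots> = (\<Sum>x\<in>F. cnj c * complex_of_real (\<mu> x * ((\<phi> x)\<^sup>2 * (cmod (u x))\<^sup>2))
        - complex_of_real (W x * (\<mu> x * ((\<phi> x)\<^sup>2 * (cmod (u x))\<^sup>2))))"
      unfolding La \<psi>_def of_real_mult complex_norm_square by (simp add: algebra_simps)
    also have "\<dots> = cnj c * complex_of_real Y - complex_of_real Z"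
      by (simp only: sum_subtractf Y_def Z_def of_real_sum sum_distrib_left)
    finally have 2: "l2_inner \<mu> \<psi> (Lap a) = cnj c * complex_of_real Y - complex_of_real Z" .
    have "fin_supp \<psi>"
      unfolding fin_supp_def by (rule finite_subset[OF _ \<phi>(1)]) (auto simp: \<psi>_def)
    from Lap_green[OF this, of a] 1 2 show ?thesis by simp
  qed
  have term0: "0 \<le> \<mu> x * ((\<phi> x)\<^sup>2 * (cmod (u x))\<^sup>2)" for x by simp
  have YU: "Y \<le> U"
  proof -
    have "Y \<le> (\<Sum>x\<in>F. \<mu> x * (cmod (u x))\<^sup>2)"
      unfolding Y_def
    proof (intro sum_mono mult_left_mono)
      show "(\<phi> x)\<^sup>2 * (cmod (u x))\<^sup>2 \<le> (cmod (u x))\<^sup>2" for x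
        using \<phi>(2)[of x] by (simp add: abs_square_le_1 mult_left_le_one_le)
    qed simp
    then show ?thesis using Su by linarith
  qed
  have "- Z \<le> M * Y"
    unfolding Z_def Y_def sum_distrib_left sum_negf[symmetric]
  proof (rule sum_mono)
    fix x
    show "- (W x * (\<mu> x * ((\<phi> x)\<^sup>2 * (cmod (u x))\<^sup>2))) \<le> M * (\<mu> x * ((\<phi> x)\<^sup>2 * (cmod (u x))\<^sup>2))"
    proof (cases "\<phi> x = 0")
      case False
      from mult_right_mono[OF W[OF this] term0[of x]] show ?thesis by (simp add: algebra_simps)
    qed simp
  qed
  also have "\<dots> \<le> M * U" by (rule mult_left_mono[OF YU M])
  finally have Z: "- Z \<le> M * U" .
  \<comment> \<open>As c is imaginary, \<open>Y\<close> drops out of the real part; t = 1/2 absorbs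
    half of \<open>X\<close> on the left.\<close>
  have "Re (complex_of_real X + R) = Re (cnj c * complex_of_real Y - complex_of_real Z)"
    by (simp only: id)
  then have "X = - Re R - Z" using c by auto
  moreover have "\<bar>Re R\<bar> \<le> cmod R" by (rule abs_Re_le_cmod)
  moreover have "cmod R \<le> (1 / 2) * X + (1 / (1 / 2) + 3) * \<epsilon>\<^sup>2 * U" by (rule Rb) simp
  ultimately have X: "X \<le> 2 * M * U + 10 * \<epsilon>\<^sup>2 * U" using Z by (simp add: algebra_simps)
  \<comment> \<open>\<open>X\<close> and \<open>Z\<close> are real, so the imaginary part leaves
    \<open>Y\<close> up to sign against \<open>R\<close> alone.\<close>
  have "Im (complex_of_real X + R) = Im (cnj c * complex_of_real Y - complex_of_real Z)"
    by (simp only: id)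
  then have "Y \<le> \<bar>Im R\<bar>" using c by auto
  also have "\<dots> \<le> cmod R" by (rule abs_Im_le_cmod)
  also have "\<dots> \<le> \<tau> * X + (1 / \<tau> + 3) * \<epsilon>\<^sup>2 * U" by (rule Rb[OF \<tau>])
  also have "\<dots> \<le> \<tau> * (2 * M * U + 10 * \<epsilon>\<^sup>2 * U) + (1 / \<tau> + 3) * \<epsilon>\<^sup>2 * U"
    using mult_left_mono[OF X, of \<tau>] \<tau> by simp
  also have "\<dots> = (\<tau> * (2 * M + 10 * \<epsilon>\<^sup>2) + (1 / \<tau> + 3) * \<epsilon>\<^sup>2) * U"
    by (simp add: algebra_simps)
  finally have Yb: "Y \<le> (\<tau> * (2 * M + 10 * \<epsilon>\<^sup>2) + (1 / \<tau> + 3) * \<epsilon>\<^sup>2) * U" .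
  have "\<mu> z * ((\<phi> z)\<^sup>2 * (cmod (u z))\<^sup>2) \<le> Y"
  proof (cases "z \<in> F")
    case True
    show ?thesis unfolding Y_def by (rule member_le_sum[OF True]) (use F in auto)
  next
    case False
    then have "\<phi> z = 0" using F(2) by (auto simp: A_def)
    then show ?thesis by (simp add: Y_def sum_nonneg)
  qed
  then show ?thesis using Yb by (simp add: U_def mult.assoc)
qed

end

section \<open>Logarithmic cutoffs\<close>

lemma comb_dist_walk:
  assumes "graph_connected b"
  shows "walk b (comb_dist b x y) x y"
  using assms unfolding comb_dist_def graph_connected_def by (metis LeastI)

lemma walk_Suc: "walk b (Suc n) x z \<longleftrightarrow> (\<exists>y. walk b n x y \<and> 0 < b y z)"
proof
  assume "walk b (Suc n) x z"
  then show "\<exists>y. walk b n x y \<and> 0 < b y z"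
    unfolding walk_def by (metis lessI less_Suc_eq)
next
  assume "\<exists>y. walk b n x y \<and> 0 < b y z"
  then obtain y p where p: "p 0 = x" "p n = y" "\<forall>i<n. 0 < b (p i) (p (Suc i))" "0 < b y z"
    unfolding walk_def by blast
  have "(p(Suc n := z)) 0 = x \<and> (p(Suc n := z)) (Suc n) = z \<and>
      (\<forall>i<Suc n. 0 < b ((p(Suc n := z)) i) ((p(Suc n := z)) (Suc i)))"
    using p by (auto simp: less_Suc_eq)
  then show "walk b (Suc n) x z" unfolding walk_def by blast
qed

lemma comb_dist_edge:
  assumes "graph_connected b" "0 < b y z"
  shows "comb_dist b x z \<le> Suc (comb_dist b x y)"
proof -
  have "walk b (Suc (comb_dist b x y)) x z"
    using comb_dist_walk[OF assms(1)] assms(2) unfolding walk_Suc by blast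
  then show ?thesis unfolding comb_dist_def[of b x z] by (rule Least_le)
qed

lemma finite_walk_sphere:
  assumes "\<And>x. finite {y. 0 < b x y}"
  shows "finite {z. walk b n x z}"
proof (induction n)
  case 0
  have "{z. walk b 0 x z} \<subseteq> {x}" by (auto simp: walk_def)
  then show ?case by (rule finite_subset) simp
next
  case (Suc n)
  have "{z. walk b (Suc n) x z} = (\<Union>y\<in>{y. walk b n x y}. {z. 0 < b y z})"
    by (auto simp: walk_Suc)
  then show ?case using Suc assms by simp
qed

lemma finite_comb_ball:
  assumes "graph_connected b" "\<And>x. finite {y. 0 < b x y}"
  shows "finite {z. comb_dist b x z \<le> n}"
proof (rule finite_subset)
  show "{z. comb_dist b x z \<le> n} \<subseteq> (\<Union>k\<le>n. {z. walk b k x z})"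
    using comb_dist_walk[OF assms(1)] by auto
  show "finite (\<Union>k\<le>n. {z. walk b k x z})"
    using finite_walk_sphere[OF assms(2)] by simp
qed

lemma degree_sum_le_dn_pn:
  assumes conn: "graph_connected b" and fin: "\<And>x. finite {y. 0 < b x y}" and nn: "\<And>x y. 0 \<le> b x y"
    and x: "comb_dist b x0 x \<le> n"
  shows "(\<Sum>y\<in>{y. 0 < b x y}. b x y) \<le> dn b x0 n * pn b x0 n"
proof -
  let ?B = "{z. comb_dist b x0 z \<le> n}"
  have B: "finite ?B" by (rule finite_comb_ball[OF conn fin])
  have "deg b x \<in> {deg b x | x. comb_dist b x0 x \<le> n}" using x by blast
  \<comment> \<open>\<open>Max\<close> bounds the elements of a set only when the set is finite, so
    finiteness of the ball enters here and again for \<open>pn\<close>.\<close>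
  moreover have "finite {deg b x | x. comb_dist b x0 x \<le> n}"
    using finite_imageI[OF B, of "deg b"] by (simp add: setcompr_eq_image)
  ultimately have d: "real (deg b x) \<le> dn b x0 n"
    unfolding dn_def by simp
  let ?P = "{b x y | x y. comb_dist b x0 x \<le> n}"
  have "finite ?P"
  proof (rule finite_subset)
    \<comment> \<open>Although y runs over all vertices, every non-neighbour contributes the same
      value 0, so only finitely many values occur.\<close>
    show "?P \<subseteq> {0} \<union> (\<Union>x\<in>?B. b x ` {y. 0 < b x y})"
      using nn by (fastforce simp: less_le)
    show "finite ({0} \<union> (\<Union>x\<in>?B. b x ` {y. 0 < b x y}))"
      using B fin by simp
  qed
  then have p: "b x y \<le> pn b x0 n" for y
    unfolding pn_def by (rule Max_ge) (use x in blast)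
  have "(\<Sum>y\<in>{y. 0 < b x y}. b x y) \<le> real (deg b x) * pn b x0 n"
    using sum_bounded_above[of "{y. 0 < b x y}" "b x" "pn b x0 n"] p by (simp add: deg_def)
  also have "\<dots> \<le> dn b x0 n * pn b x0 n"
    by (rule mult_right_mono[OF d]) (use p[of x] nn[of x x] in linarith)
  finally show ?thesis .
qed

section \<open>Elementary bounds for powers and logarithms\<close>

lemma powr_growth_bound:
  fixes q :: "real \<Rightarrow> real"
  assumes \<alpha>: "0 \<le> \<alpha>" and q: "q \<in> O(\<lambda>s. s powr \<alpha>)" and mono: "mono_on {0..} q"
  obtains C where "0 < C" "\<And>s. 0 \<le> s \<Longrightarrow> q s \<le> C * (1 + s) powr \<alpha>"
proof -
  obtain c where c: "0 < c" "\<forall>\<^sub>F s in at_top. norm (q s) \<le> c * norm (s powr \<alpha>)"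
    using landau_o.bigE[OF q] by blast
  then obtain s0 where s0: "\<And>s. s \<ge> s0 \<Longrightarrow> norm (q s) \<le> c * norm (s powr \<alpha>)"
    unfolding eventually_at_top_linorder by blast
  define s1 where "s1 = max s0 0"
  show ?thesis
  \<comment> \<open>\<open>c\<close> serves for large s, and by monotonicity the value at
    \<open>s1\<close> serves for the rest. The base \<open>1 + s\<close> keeps the power at least 1
    down to s = 0.\<close>
  proof (rule that[of "c + \<bar>q s1\<bar>"])
    show "0 < c + \<bar>q s1\<bar>" using c by simp
    fix s :: real assume s: "0 \<le> s"
    have one: "1 \<le> (1 + s) powr \<alpha>" using s \<alpha> by (simp add: ge_one_powr_ge_zero)
    show "q s \<le> (c + \<bar>q s1\<bar>) * (1 + s) powr \<alpha>"
    proof (cases "s \<ge> s1")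
      case True
      then have "q s \<le> c * s powr \<alpha>" using s0[of s] s by (simp add: s1_def)
      also have "\<dots> \<le> (c + \<bar>q s1\<bar>) * (1 + s) powr \<alpha>"
        using c s \<alpha> by (intro mult_mono powr_mono2) auto
      finally show ?thesis .
    next
      case False
      then have "q s \<le> q s1" using s by (intro mono_onD[OF mono]) auto
      also have "\<dots> \<le> (c + \<bar>q s1\<bar>) * 1" using c by simp
      also have "\<dots> \<le> (c + \<bar>q s1\<bar>) * (1 + s) powr \<alpha>"
        by (rule mult_left_mono[OF one]) (use c in simp)
      finally show ?thesis .
    qed
  qed
qed

lemma clamp_abs_diff_le:
  fixes s t :: real
  shows "\<bar>max 0 (min 1 s) - max 0 (min 1 t)\<bar> \<le> \<bar>s - t\<bar>"
  by (auto simp: max_def min_def)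

text \<open>Both signs follow from \<open>ln u \<le> u - 1\<close> applied to a quotient; the factor
  2 pays for replacing \<open>1 / t\<close> by a multiple of \<open>1 / s\<close>.\<close>

lemma abs_ln_diff_le:
  fixes s t :: real
  assumes "2 \<le> s" "s \<le> 2 * t" "\<bar>s - t\<bar> \<le> 1"
  shows "\<bar>ln s - ln t\<bar> \<le> 2 / s"
proof -
  have t: "0 < t" using assms by linarith
  have *: "ln u - ln v \<le> 1 / v" if "0 < u" "0 < v" "u - v \<le> 1" for u v :: real
  proof -
    have "ln (u / v) \<le> u / v - 1" by (rule ln_le_minus_one) (use that in simp)
    also have "\<dots> = (u - v) / v" using that by (simp add: diff_divide_distrib)
    also have "\<dots> \<le> 1 / v" using that by (intro divide_right_mono) auto
    finally show ?thesis using that by (simp add: ln_div)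
  qed
  have "ln s - ln t \<le> 1 / t" by (rule *) (use assms t in auto)
  moreover have "1 / t \<le> 2 / s" using assms t by (simp add: field_simps)
  moreover have "ln t - ln s \<le> 1 / s" by (rule *) (use assms t in auto)
  moreover have "1 / s \<le> 2 / s" using assms by (intro divide_right_mono) auto
  ultimately show ?thesis by linarith
qed

section \<open>Vanishing of eigenvectors by logarithmic cutoffs\<close>

context magnetic_graph
begin

text \<open>The powers of the radius cancel or leave a nonpositive exponent, so the estimate at z is
  of order 1 / ln N and the logarithm alone drives it to zero. Of the distance, only the Lipschitz
  property along edges and finite balls enter.\<close>

lemma no_eigenvector:
  fixes r :: "'v \<Rightarrow> nat"
  assumes edge: "\<And>x y. 0 < b x y \<Longrightarrow> r y \<le> Suc (r x)"
    and ball: "\<And>n. finite {x. r x \<le> n}"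
    and \<alpha>: "0 \<le> \<alpha>" "\<alpha> \<le> 1" and K: "0 \<le> K"
    and deg_growth: "\<And>x. (\<Sum>y\<in>nbrs x. b x y) \<le> K * (1 + real (r x)) powr (1 - \<alpha>) * \<mu> x"
    and W_growth: "\<And>x. - (K * (1 + real (r x)) powr \<alpha>) \<le> W x"
    and u: "in_l2 \<mu> u" and c: "c = \<i> \<or> c = - \<i>" and eig: "\<And>x. formal_H u x = c * u x"
  shows "u z = 0"
proof -
  define \<rho> where "\<rho> x = 1 + real (r x)" for x
  have \<rho>: "1 \<le> \<rho> x" for x by (simp add: \<rho>_def)
  have \<rho>_edge: "\<bar>\<rho> x - \<rho> y\<bar> \<le> 1" if "0 < b x y" for x y
    using edge[OF that] edge[of y x] that b_sym[of x y] by (simp add: \<rho>_def)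
  \<comment> \<open>2 K comes from \<open>2 * \<tau> * M\<close>; 3584 is 14 times 256, where 14 =
    10 + 1 + 3 counts the terms in \<open>\<epsilon>\<^sup>2\<close> and 256 is the square of the 16
    in \<open>\<epsilon>\<close>.\<close>
  define Q where "Q = (2 * K + 3584 * K\<^sup>2) * sq_norm \<mu> u"
  have bound: "\<mu> z * (cmod (u z))\<^sup>2 \<le> Q / ln (real N)"
    if N: "3 \<le> N" "\<rho> z \<le> real N" for N :: nat
  proof -
    define n where "n = real N"
    define L where "L = ln n"
    \<comment> \<open>The unclamped expression is 1 at radius n and 0 at radius n to the
      3/2.\<close>
    define \<phi> where "\<phi> x = max 0 (min 1 (3 - 2 * ln (\<rho> x) / L))" for x
    \<comment> \<open>The slope 2 / L in the logarithm times the jump 2 / \<rho> of the logarithm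
      along an edge.\<close>
    define \<eta> where "\<eta> x = (if n \<le> \<rho> x then 4 / (L * \<rho> x) else 0)" for x
    \<comment> \<open>16 is 8 times 2: the 8 is the common constant for rows and columns in
      \<open>main\<close>, the 2 bounds \<open>2 powr \<alpha>\<close>.\<close>
    define \<epsilon> where "\<epsilon> = 16 * K * n powr (- \<alpha>) / L"
    define M where "M = K * n powr (3 / 2 * \<alpha>)"
    \<comment> \<open>Chosen so that \<open>\<tau> * M\<close> is \<open>K / L\<close>. Then
      \<open>\<epsilon>\<^sup>2 / \<tau>\<close> carries the power \<open>- \<alpha> / 2\<close> of
      n, which is harmless because 3/2 is below 2.\<close>
    define \<tau> where "\<tau> = n powr (- (3 / 2 * \<alpha>)) / L"
    have n: "3 \<le> n" using N by (simp add: n_def)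
    have L: "1 \<le> L"
      using n exp_le by (simp add: L_def ln_ge_iff)
    have powr_le: "n powr (- s) \<le> 1" if "0 \<le> s" for s
      using n that by (simp add: powr_minus inverse_le_1_iff ge_one_powr_ge_zero)
    have \<phi>1: "\<phi> x = 1" if "\<rho> x \<le> n" for x
    proof -
      have "ln (\<rho> x) \<le> L" using that \<rho>[of x] by (simp add: L_def)
      then have "2 * ln (\<rho> x) / L \<le> 2" using L by (simp add: divide_le_eq)
      then show ?thesis by (simp add: \<phi>_def)
    qed
    have \<phi>_supp: "\<rho> x \<le> n powr (3 / 2)" if "\<phi> x \<noteq> 0" for x
    proof (rule ccontr)
      assume "\<not> ?thesis"
      then have "ln (n powr (3 / 2)) \<le> ln (\<rho> x)"
        using n \<rho>[of x] by (subst ln_le_cancel_iff) auto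
      then have "3 \<le> 2 * ln (\<rho> x) / L" using n L by (simp add: ln_powr L_def le_divide_eq)
      then show False using that by (simp add: \<phi>_def)
    qed
    have "\<mu> z * (\<phi> z)\<^sup>2 * (cmod (u z))\<^sup>2
        \<le> (\<tau> * (2 * M + 10 * \<epsilon>\<^sup>2) + (1 / \<tau> + 3) * \<epsilon>\<^sup>2) * sq_norm \<mu> u"
    proof (rule cutoff_estimate[OF u c eig])
      show "finite {x. \<phi> x \<noteq> 0}"
      proof (rule finite_subset)
        show "{x. \<phi> x \<noteq> 0} \<subseteq> {x. r x \<le> nat \<lfloor>n powr (3 / 2)\<rfloor>}"
          using \<phi>_supp by (force simp: \<rho>_def le_nat_floor)
      qed (rule ball)
      show "\<bar>\<phi> x\<bar> \<le> 1" for x by (simp add: \<phi>_def)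
      show "0 \<le> \<eta> x" for x using L \<rho>[of x] by (simp add: \<eta>_def)
      show "\<bar>\<phi> x - \<phi> y\<bar> \<le> \<eta> x" if e: "0 < b x y" for x y
      proof (cases "n \<le> \<rho> x")
        case True
        have "\<bar>\<phi> x - \<phi> y\<bar> \<le> \<bar>(3 - 2 * ln (\<rho> x) / L) - (3 - 2 * ln (\<rho> y) / L)\<bar>"
          unfolding \<phi>_def by (rule clamp_abs_diff_le)
        also have "(3 - 2 * ln (\<rho> x) / L) - (3 - 2 * ln (\<rho> y) / L) = (2 / L) * (ln (\<rho> y) - ln (\<rho> x))"
          by (simp add: right_diff_distrib)
        also have "\<bar>\<dots>\<bar> = (2 / L) * \<bar>ln (\<rho> x) - ln (\<rho> y)\<bar>"
          unfolding abs_mult abs_minus_commute[of "ln (\<rho> y)"] using L by simp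
        also have "\<dots> \<le> (2 / L) * (2 / \<rho> x)"
          using True n \<rho>_edge[OF e] L by (intro mult_left_mono abs_ln_diff_le) auto
        finally show ?thesis using True by (simp add: \<eta>_def)
      next
        case False
        \<comment> \<open>\<open>\<rho>\<close> is integer valued, so one step from below n reaches
          at most n, and the cutoff is 1 at both ends of the edge.\<close>
        then have "Suc (r x) < N" by (simp add: \<rho>_def n_def)
        then have "\<rho> x \<le> n" "\<rho> y \<le> n" using edge[OF e] by (simp_all add: \<rho>_def n_def)
        then show ?thesis using False by (simp add: \<phi>1 \<eta>_def)
      qed
      show "0 \<le> \<epsilon>" using K L by (simp add: \<epsilon>_def)
      \<comment> \<open>8 instead of 4 serves rows and columns at once, as adjacent values of
        \<open>\<rho>\<close> differ by a factor of at most 2 where \<open>\<eta>\<close> is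
        nonzero. Below radius n / 2 every neighbour stays below n, so the column vanishes.\<close>
      have main: "(\<Sum>y\<in>nbrs x. b x y * (8 / (L * \<rho> x))) \<le> \<epsilon> * \<mu> x" if x: "n / 2 \<le> \<rho> x" for x
      proof -
        have "\<rho> x powr (- \<alpha>) \<le> (n / 2) powr (- \<alpha>)"
          using x n \<alpha> by (intro powr_mono2') auto
        also have "\<dots> = 2 powr \<alpha> * n powr (- \<alpha>)"
          using n by (simp add: powr_divide powr_minus field_simps)
        also have "\<dots> \<le> 2 * n powr (- \<alpha>)"
          using powr_mono[OF \<alpha>(2), of 2] by (intro mult_right_mono) auto
        finally have 1: "\<rho> x powr (- \<alpha>) \<le> 2 * n powr (- \<alpha>)" .
        have 2: "\<rho> x powr (1 - \<alpha>) / \<rho> x = \<rho> x powr (- \<alpha>)"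
          using \<rho>[of x] by (simp add: powr_diff powr_minus field_simps)
        have "(\<Sum>y\<in>nbrs x. b x y * (8 / (L * \<rho> x))) = (\<Sum>y\<in>nbrs x. b x y) * (8 / (L * \<rho> x))"
          by (simp only: sum_distrib_right)
        also have "\<dots> \<le> (K * \<rho> x powr (1 - \<alpha>) * \<mu> x) * (8 / (L * \<rho> x))"
          using deg_growth[of x] L \<rho>[of x] by (intro mult_right_mono) (auto simp: \<rho>_def)
        also have "\<dots> = (8 * K / L * \<mu> x) * (\<rho> x powr (1 - \<alpha>) / \<rho> x)" by simp
        also have "\<dots> \<le> (8 * K / L * \<mu> x) * (2 * n powr (- \<alpha>))"
          unfolding 2 using K L by (intro mult_left_mono[OF 1]) auto
        also have "\<dots> = \<epsilon> * \<mu> x" by (simp add: \<epsilon>_def)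
        finally show ?thesis .
      qed
      have \<epsilon>\<mu>: "0 \<le> \<epsilon> * \<mu> x" for x using \<open>0 \<le> \<epsilon>\<close> by simp
      show "(\<Sum>y\<in>nbrs x. b x y * \<eta> x) \<le> \<epsilon> * \<mu> x" for x
      proof (cases "n \<le> \<rho> x")
        case True
        have "(\<Sum>y\<in>nbrs x. b x y * \<eta> x) \<le> (\<Sum>y\<in>nbrs x. b x y * (8 / (L * \<rho> x)))"
          using True L \<rho>[of x] b_nonneg
          by (intro sum_mono mult_left_mono) (auto simp: \<eta>_def intro!: divide_right_mono)
        also have "\<dots> \<le> \<epsilon> * \<mu> x" by (rule main) (use True n in simp)
        finally show ?thesis .
      qed (use \<epsilon>\<mu> in \<open>simp add: \<eta>_def\<close>)
      show "(\<Sum>x\<in>nbrs y. b y x * \<eta> x) \<le> \<epsilon> * \<mu> y" for y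
      proof (cases "n / 2 \<le> \<rho> y")
        case True
        have "\<eta> x \<le> 8 / (L * \<rho> y)" if "x \<in> nbrs y" for x
        proof (cases "n \<le> \<rho> x")
          case nx: True
          have "\<rho> y \<le> 2 * \<rho> x" using \<rho>_edge[of y x] that nx n by auto
          then have "4 / (L * \<rho> x) \<le> 8 / (L * \<rho> y)"
            using L \<rho>[of x] \<rho>[of y] by (simp add: field_simps)
          then show ?thesis using nx by (simp add: \<eta>_def)
        qed (use L \<rho>[of y] in \<open>simp add: \<eta>_def\<close>)
        then have "(\<Sum>x\<in>nbrs y. b y x * \<eta> x) \<le> (\<Sum>x\<in>nbrs y. b y x * (8 / (L * \<rho> y)))"
          using b_nonneg by (intro sum_mono mult_left_mono) auto
        also have "\<dots> \<le> \<epsilon> * \<mu> y" by (rule main[OF True])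
        finally show ?thesis .
      next
        case False
        have "\<eta> x = 0" if "x \<in> nbrs y" for x
          using \<rho>_edge[of y x] that False n by (auto simp: \<eta>_def)
        then show ?thesis using \<epsilon>\<mu> by simp
      qed
      show "- M \<le> W x" if "\<phi> x \<noteq> 0" for x
      proof -
        have "\<rho> x powr \<alpha> \<le> (n powr (3 / 2)) powr \<alpha>"
          using \<phi>_supp[OF that] \<rho>[of x] \<alpha> by (intro powr_mono2) auto
        then have "K * \<rho> x powr \<alpha> \<le> M"
          unfolding M_def powr_powr by (rule mult_left_mono[OF _ K])
        then show ?thesis using W_growth[of x] by (simp add: \<rho>_def)
      qed
      show "0 \<le> M" using K by (simp add: M_def)
      show "0 < \<tau>" using n L by (simp add: \<tau>_def)
    qed
    also have "\<phi> z = 1" by (rule \<phi>1) (use N in \<open>simp add: n_def\<close>)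
    also have "(\<tau> * (2 * M + 10 * \<epsilon>\<^sup>2) + (1 / \<tau> + 3) * \<epsilon>\<^sup>2) * sq_norm \<mu> u \<le> Q / L"
    proof -
      have \<tau>: "0 < \<tau>" "\<tau> \<le> 1"
        using n L powr_le[of "3 / 2 * \<alpha>"] \<alpha> by (auto simp: \<tau>_def divide_le_eq)
      have \<tau>M: "\<tau> * M = K / L"
        using n by (simp add: \<tau>_def M_def powr_minus field_simps)
      have e: "\<epsilon>\<^sup>2 = 256 * K\<^sup>2 * n powr (- 2 * \<alpha>) / L\<^sup>2"
        using n by (simp add: \<epsilon>_def power_divide power_mult_distrib powr_power)
      have LL: "L \<le> L\<^sup>2" using L by (simp add: power2_eq_square)
      have "\<epsilon>\<^sup>2 \<le> 256 * K\<^sup>2 * 1 / L\<^sup>2"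
        unfolding e using powr_le[of "2 * \<alpha>"] \<alpha> by (intro divide_right_mono mult_left_mono) auto
      also have "\<dots> \<le> 256 * K\<^sup>2 / L"
        using LL L by (auto intro!: divide_left_mono)
      finally have e1: "\<epsilon>\<^sup>2 \<le> 256 * K\<^sup>2 / L" .
      have "1 / \<tau> * \<epsilon>\<^sup>2 = 256 * K\<^sup>2 * (n powr (3 / 2 * \<alpha>) * n powr (- 2 * \<alpha>)) / L"
        unfolding e using n L by (simp add: \<tau>_def powr_minus power2_eq_square field_simps)
      also have "n powr (3 / 2 * \<alpha>) * n powr (- 2 * \<alpha>) = n powr (- (\<alpha> / 2))"
        by (simp add: powr_add[symmetric])
      also have "256 * K\<^sup>2 * n powr (- (\<alpha> / 2)) / L \<le> 256 * K\<^sup>2 * 1 / L"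
        using powr_le[of "\<alpha> / 2"] \<alpha> L by (intro divide_right_mono mult_left_mono) auto
      finally have e2: "1 / \<tau> * \<epsilon>\<^sup>2 \<le> 256 * K\<^sup>2 / L" by simp
      have e3: "\<tau> * \<epsilon>\<^sup>2 \<le> 1 * (256 * K\<^sup>2 / L)"
        using \<tau> e1 by (intro mult_mono) auto
      have "\<tau> * (2 * M + 10 * \<epsilon>\<^sup>2) + (1 / \<tau> + 3) * \<epsilon>\<^sup>2
          = 2 * (\<tau> * M) + 10 * (\<tau> * \<epsilon>\<^sup>2) + 1 / \<tau> * \<epsilon>\<^sup>2 + 3 * \<epsilon>\<^sup>2"
        by (simp add: algebra_simps)
      also have "\<dots> \<le> 2 * (K / L) + 10 * (256 * K\<^sup>2 / L) + 256 * K\<^sup>2 / L + 3 * (256 * K\<^sup>2 / L)"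
        using e1 e2 e3 \<tau>M by linarith
      also have "\<dots> = (2 * K + 3584 * K\<^sup>2) / L" by (simp add: add_divide_distrib)
      finally show ?thesis
        unfolding Q_def times_divide_eq_left[symmetric] by (rule mult_right_mono) simp
    qed
    finally show ?thesis by (simp add: L_def n_def)
  qed
  \<comment> \<open>The vertex z is fixed; every N from 3 on with \<open>\<rho> z \<le> N\<close> is
    admissible, and the bound tends to 0.\<close>
  have "\<mu> z * (cmod (u z))\<^sup>2 \<le> 0"
  proof (rule tendsto_lowerbound)
    show "(\<lambda>N. Q / ln (real N)) \<longlonglongrightarrow> 0"
      by (intro real_tendsto_divide_at_top[OF tendsto_const]
          filterlim_compose[OF ln_at_top filterlim_real_sequentially])
    show "\<forall>\<^sub>F N in sequentially. \<mu> z * (cmod (u z))\<^sup>2 \<le> Q / ln (real N)"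
      using eventually_ge_at_top[of "max 3 (Suc (r z))"]
      by eventually_elim (rule bound, auto simp: \<rho>_def)
  qed simp
  then show ?thesis using m_pos[of z] by (simp add: mult_le_0_iff)
qed

end

section \<open>From the growth hypotheses to the cutoff argument\<close>

theorem theorem2p1:
  fixes b :: "'v \<Rightarrow> 'v \<Rightarrow> real" and \<mu> :: "'v \<Rightarrow> real" and \<theta> :: "'v \<Rightarrow> 'v \<Rightarrow> real"
    and q :: "real \<Rightarrow> real" and W :: "'v \<Rightarrow> real" and x0 :: 'v
    and \<mu>0 \<alpha> :: real
  assumes countV: "countable (UNIV :: 'v set)" and infV: "infinite (UNIV :: 'v set)"
    and mu_pos: "\<And>x. 0 < \<mu> x"
    and b_nonneg: "\<And>x y. 0 \<le> b x y"
    and b_sym: "\<And>x y. b x y = b y x"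
    and b_diag: "\<And>x. b x x = 0"
    and deg_fin: "\<And>x. finite {y. 0 < b x y}"
    and conn: "graph_connected b"
    and mu0_pos: "0 < \<mu>0" and mu_ge: "\<And>x. \<mu> x \<ge> \<mu>0"
    and theta_range: "\<And>x y. -pi \<le> \<theta> x y \<and> \<theta> x y \<le> pi"
    and theta_anti: "\<And>x y. \<theta> x y = - \<theta> y x"
    and q_pos: "\<And>s. 0 \<le> s \<Longrightarrow> 0 < q s"
    and q_mono: "mono_on {0..} q"
    and alpha: "0 \<le> \<alpha>" "\<alpha> \<le> 1"
    and q_growth: "q \<in> O(\<lambda>s. s powr \<alpha>)"
    and W_lower: "\<And>x. W x \<ge> - q (real (comb_dist b x0 x))"
    and case_pos: "0 < \<alpha> \<Longrightarrow>
       (\<exists>C. \<forall>n::nat. n \<ge> 1 \<longrightarrow> \<bar>real n powr (\<alpha> - 1) * dn b x0 n * pn b x0 n\<bar> \<le> C)"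
    and case_zero: "\<alpha> = 0 \<Longrightarrow>
       (\<exists>K (N::nat). 0 < K \<and> K < \<mu>0 / 2 \<and> N \<ge> 1 \<and>
          (\<forall>n. n \<ge> N \<longrightarrow> dn b x0 n * pn b x0 n / real n \<le> K))"
  shows "ess_self_adjoint \<mu> (H_graph b \<mu> \<theta> W)"
proof -
  interpret magnetic_graph \<mu> b \<theta> W
    by unfold_locales (fact mu_pos b_nonneg b_sym deg_fin theta_anti)+
  define r where "r = comb_dist b x0"
  \<comment> \<open>Both cases are brought to one form: the sequence is bounded above by a constant
    for all indices from 1 on.\<close>
  have "\<exists>C. \<forall>n\<ge>1. real n powr (\<alpha> - 1) * (dn b x0 n * pn b x0 n) \<le> C"
  proof (cases "\<alpha> = 0")
    case True
    then obtain K N where K: "0 < K" "\<And>n::nat. n \<ge> N \<Longrightarrow> dn b x0 n * pn b x0 n / real n \<le> K"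
      using case_zero by blast
    let ?f = "\<lambda>n::nat. real n powr (- 1) * (dn b x0 n * pn b x0 n)"
    \<comment> \<open>The hypothesis speaks about indices from \<open>N\<close> on; the finitely
      many earlier terms are dominated by the sum of their absolute values.\<close>
    have "?f n \<le> K + (\<Sum>k<N. \<bar>?f k\<bar>)" for n
    proof (cases "n \<ge> N")
      case True
      have "?f n \<le> K" using K(2)[OF True] by (simp add: powr_minus divide_inverse mult.commute)
      moreover have "0 \<le> (\<Sum>k<N. \<bar>?f k\<bar>)" by (rule sum_nonneg) simp
      ultimately show ?thesis by linarith
    next
      case False
      then have "\<bar>?f n\<bar> \<le> (\<Sum>k<N. \<bar>?f k\<bar>)" by (intro member_le_sum) auto
      then show ?thesis using K(1) by linarith
    qed
    then show ?thesis unfolding True by auto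
  next
    case False
    then obtain C where "\<And>n::nat. n \<ge> 1 \<Longrightarrow> \<bar>real n powr (\<alpha> - 1) * dn b x0 n * pn b x0 n\<bar> \<le> C"
      using case_pos alpha by fastforce
    then show ?thesis by (intro exI[of _ C]) (auto simp: mult.assoc abs_le_iff)
  qed
  then obtain C where C: "\<And>n::nat. n \<ge> 1 \<Longrightarrow> real n powr (\<alpha> - 1) * (dn b x0 n * pn b x0 n) \<le> C"
    by blast
  obtain C' where C': "0 < C'" "\<And>s. 0 \<le> s \<Longrightarrow> q s \<le> C' * (1 + s) powr \<alpha>"
    using powr_growth_bound[OF alpha(1) q_growth q_mono] by blast
  define K where "K = max C' (\<bar>C\<bar> / \<mu>0)"
  have K: "0 \<le> K" using C' by (simp add: K_def)
  have deg_growth: "(\<Sum>y\<in>nbrs x. b x y) \<le> K * (1 + real (r x)) powr (1 - \<alpha>) * \<mu> x" for x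
  proof -
    \<comment> \<open>The ball has radius \<open>r x + 1\<close>: the bound \<open>C\<close> starts
      at index 1 while \<open>r x\<close> may be 0, and the radius then equals the base of the
      power.\<close>
    let ?n = "Suc (r x)"
    let ?s = "1 + real (r x)"
    have "(\<Sum>y\<in>nbrs x. b x y) \<le> dn b x0 ?n * pn b x0 ?n"
      by (rule degree_sum_le_dn_pn[OF conn deg_fin b_nonneg]) (simp add: r_def)
    also have "\<dots> = (?s powr (\<alpha> - 1) * (dn b x0 ?n * pn b x0 ?n)) * ?s powr (1 - \<alpha>)"
      by (simp add: mult.commute mult.left_commute powr_add[symmetric])
    also have "\<dots> \<le> \<bar>C\<bar> * ?s powr (1 - \<alpha>)"
      using C[of ?n] by (intro mult_right_mono) auto
    \<comment> \<open>The uniform lower bound on the weight turns a constant into a multiple of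
      \<open>\<mu> x\<close>, as the Schur test requires.\<close>
    also have "\<dots> = \<bar>C\<bar> / \<mu>0 * ?s powr (1 - \<alpha>) * \<mu>0" using mu0_pos by simp
    also have "\<dots> \<le> K * ?s powr (1 - \<alpha>) * \<mu> x"
      using mu0_pos mu_ge[of x] K by (intro mult_mono) (auto simp: K_def)
    finally show ?thesis .
  qed
  have W_growth: "- (K * (1 + real (r x)) powr \<alpha>) \<le> W x" for x
  proof -
    have "q (real (r x)) \<le> C' * (1 + real (r x)) powr \<alpha>" by (rule C') simp
    also have "\<dots> \<le> K * (1 + real (r x)) powr \<alpha>" by (rule mult_right_mono) (auto simp: K_def)
    finally show ?thesis using W_lower[of x] by (simp add: r_def)
  qed
  show ?thesis
  proof (rule ess_self_adjoint_if_no_eigenvector, rule ext)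
    fix u c z
    assume u: "in_l2 \<mu> u" and c: "c = \<i> \<or> c = - \<i>" and eig: "\<And>x. formal_H u x = c * u x"
    show "u z = 0"
      by (rule no_eigenvector[OF _ _ alpha K deg_growth W_growth u c eig])
         (auto simp: r_def intro: comb_dist_edge[OF conn] finite_comb_ball[OF conn deg_fin])
  qed
qed

end
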